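(* Let $k$ be a field and let $Q$ be a quiver. The path coalgebra $kQ$ admits a graded Hopf algebra structure if and only if $Q$ is the Hopf quiver of some group with respect to a ramification data.
   Context: A quiver $Q$ consists of two sets $Q_0$ (vertices) and $Q_1$ (arrows), infinite sets being allowed, and two maps $s,t:Q_1\to Q_0$ (source and terminus). A path of length $n\ge 1$ is a sequence $\alpha=a_n\cdots a_1$ of arrows with $t(a_i)=s(a_{i+1})$ for $i=1,\dots,n-1$, with $s(\alpha)=s(a_1)$ and $t(\alpha)=t(a_n)$; vertices are the paths of length $0$, each equal to its own source and terminus. $Q_n$ denotes the set of paths of length $n$. The path coalgebra $kQ$ is the $k$-vector space with basis the set of all paths, with comultiplication $\Delta\alpha=\sum_{\alpha=\alpha_{(2)}\alpha_{(1)}}\alpha_{(2)}\otimes\alpha_{(1)}$, the sum over all splits of $\alpha$ as a concatenation of two paths; explicitly, for $\alpha=a_n\cdots a_1$, $\Delta\alpha=\alpha\otimes s(\alpha)+\sum_{i=1}^{n-1}a_n\cdots a_{i+1}\otimes a_i\cdots a_1+t(\alpha)\otimes\alpha$, and $\Delta u=u\otimes u$ for a vertex $u$. The counit is $\varepsilon(u)=1$ for a vertex $u$ and $\varepsilon(\alpha)=0$ for a path $\alpha$ of positive length. It is graded by path length, with degree $n$ component $kQ_n$. A graded Hopf algebra structure on $kQ$ is an algebra structure (and antipode) making the given coalgebra $kQ$ a Hopf algebra, such that $kQ_n\cdot kQ_m\subseteq kQ_{n+m}$ for all $n,m\ge 0$, with unit in $kQ_0$. A ramification data $r$ of a group $G$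 is a positive central element of the group ring of $G$, i.e. $r=\sum_{C\in\mathcal C}r_C\,C$ is a formal sum of conjugacy classes of $G$ with non-negative integer coefficients $r_C$, where $\mathcal C$ is the set of conjugacy classes of $G$. The Hopf quiver of $G$ with respect to $r$ has as set of vertices the elements of $G$, and has $r_C$ arrows from $x$ to $cx$ for each $x\in G$, each $C\in\mathcal C$ and each $c\in C$ (and no other arrows).
   Formalization: Assumes in addition that Q has only finitely many arrows between any two vertices; without this the "only if" fails for one vertex with infinitely many loops, where kQ is graded Hopf under the shuffle product but the coefficients r_C must be integers. *)

theory Defs
  imports
    "HOL-Algebra.Group_Action"
    "HOL-Library.Poly_Mapping"
    "Graph_Theory.Graph_Theory"
begin

section \<open>Vector spaces with a given basis\<close>

text \<open>
  The \<open>k\<close>-vector space with basis \<open>B\<close> consists of the finitely supported functions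
  \<open>'b \<Rightarrow>\<^sub>0 'k\<close> whose support lies in \<open>B\<close>.  The tensor product of the spaces with bases
  \<open>B\<close> and \<open>C\<close> is the space with basis \<open>B \<times> C\<close>.
\<close>

definition free_space :: "'b set \<Rightarrow> ('b \<Rightarrow>\<^sub>0 'k::field) set" where
  "free_space B = {x. Poly_Mapping.keys x \<subseteq> B}"

definition smult :: "'k::field \<Rightarrow> ('b \<Rightarrow>\<^sub>0 'k) \<Rightarrow> ('b \<Rightarrow>\<^sub>0 'k)" where
  "smult c x = Poly_Mapping.map ((*) c) x"

definition bvec :: "'b \<Rightarrow> ('b \<Rightarrow>\<^sub>0 'k::field)" where
  "bvec b = Poly_Mapping.single b 1"

definition linear_map_on ::
    "'b set \<Rightarrow> 'c set \<Rightarrow> (('b \<Rightarrow>\<^sub>0 'k::field) \<Rightarrow> ('c \<Rightarrow>\<^sub>0 'k)) \<Rightarrow> bool" where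
  "linear_map_on B C \<phi> \<longleftrightarrow>
     \<phi> \<in> free_space B \<rightarrow> free_space C \<and>
     (\<forall>x\<in>free_space B. \<forall>y\<in>free_space B. \<phi> (x + y) = \<phi> x + \<phi> y) \<and>
     (\<forall>c. \<forall>x\<in>free_space B. \<phi> (smult c x) = smult c (\<phi> x))"

definition linear_form_on :: "'b set \<Rightarrow> (('b \<Rightarrow>\<^sub>0 'k::field) \<Rightarrow> 'k) \<Rightarrow> bool" where
  "linear_form_on B \<phi> \<longleftrightarrow>
     (\<forall>x\<in>free_space B. \<forall>y\<in>free_space B. \<phi> (x + y) = \<phi> x + \<phi> y) \<and>
     (\<forall>c. \<forall>x\<in>free_space B. \<phi> (smult c x) = c * \<phi> x)"

definition lin_ext :: "('b \<Rightarrow> ('c \<Rightarrow>\<^sub>0 'k::field)) \<Rightarrow> ('b \<Rightarrow>\<^sub>0 'k) \<Rightarrow> ('c \<Rightarrow>\<^sub>0 'k)" where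
  "lin_ext \<phi> x = (\<Sum>b\<in>Poly_Mapping.keys x. smult (Poly_Mapping.lookup x b) (\<phi> b))"

definition tensor :: "('b \<Rightarrow>\<^sub>0 'k::field) \<Rightarrow> ('c \<Rightarrow>\<^sub>0 'k) \<Rightarrow> ('b \<times> 'c \<Rightarrow>\<^sub>0 'k)" where
  "tensor x y = lin_ext (\<lambda>b. lin_ext (\<lambda>c. bvec (b, c)) y) x"

definition tensor_map ::
    "(('b \<Rightarrow>\<^sub>0 'k::field) \<Rightarrow> ('d \<Rightarrow>\<^sub>0 'k)) \<Rightarrow> (('c \<Rightarrow>\<^sub>0 'k) \<Rightarrow> ('e \<Rightarrow>\<^sub>0 'k)) \<Rightarrow>
     ('b \<times> 'c \<Rightarrow>\<^sub>0 'k) \<Rightarrow> ('d \<times> 'e \<Rightarrow>\<^sub>0 'k)" where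
  "tensor_map \<phi> \<psi> = lin_ext (\<lambda>(b, c). tensor (\<phi> (bvec b)) (\<psi> (bvec c)))"

text \<open>The product \<open>(a \<otimes> b) (c \<otimes> d) = ac \<otimes> bd\<close> on the tensor square of an algebra.\<close>

definition tensor_mul ::
    "(('b \<Rightarrow>\<^sub>0 'k::field) \<Rightarrow> ('b \<Rightarrow>\<^sub>0 'k) \<Rightarrow> ('b \<Rightarrow>\<^sub>0 'k)) \<Rightarrow>
     ('b \<times> 'b \<Rightarrow>\<^sub>0 'k) \<Rightarrow> ('b \<times> 'b \<Rightarrow>\<^sub>0 'k) \<Rightarrow> ('b \<times> 'b \<Rightarrow>\<^sub>0 'k)" where
  "tensor_mul mul X Y =
     lin_ext (\<lambda>(a, b). lin_ext (\<lambda>(c, d).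
       tensor (mul (bvec a) (bvec c)) (mul (bvec b) (bvec d))) Y) X"


section \<open>Algebras, coalgebras and Hopf algebras\<close>

text \<open>
  All structures live on the space with basis \<open>B\<close>; over a field this is no restriction.
  Operations are only constrained on \<open>free_space B\<close>.
\<close>

locale k_algebra =
  fixes B :: "'b set"
    and mul :: "('b \<Rightarrow>\<^sub>0 'k::field) \<Rightarrow> ('b \<Rightarrow>\<^sub>0 'k) \<Rightarrow> ('b \<Rightarrow>\<^sub>0 'k)"
    and u :: "'b \<Rightarrow>\<^sub>0 'k"
  assumes mul_linear_left: "y \<in> free_space B \<Longrightarrow> linear_map_on B B (\<lambda>x. mul x y)"
    and mul_linear_right: "x \<in> free_space B \<Longrightarrow> linear_map_on B B (\<lambda>y. mul x y)"
    and mul_assoc: "\<lbrakk>x \<in> free_space B; y \<in> free_space B; z \<in> free_space B\<rbrakk> \<Longrightarrow>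
          mul (mul x y) z = mul x (mul y z)"
    and unit_closed: "u \<in> free_space B"
    and unit_left: "x \<in> free_space B \<Longrightarrow> mul u x = x"
    and unit_right: "x \<in> free_space B \<Longrightarrow> mul x u = x"

locale k_coalgebra =
  fixes B :: "'b set"
    and \<Delta> :: "('b \<Rightarrow>\<^sub>0 'k::field) \<Rightarrow> ('b \<times> 'b \<Rightarrow>\<^sub>0 'k)"
    and \<epsilon> :: "('b \<Rightarrow>\<^sub>0 'k) \<Rightarrow> 'k"
  assumes comult_linear: "linear_map_on B (B \<times> B) \<Delta>"
    and counit_linear: "linear_form_on B \<epsilon>"
    and coassoc: "x \<in> free_space B \<Longrightarrow>
          lin_ext (\<lambda>((a, b), c). bvec (a, (b, c))) (tensor_map \<Delta> id (\<Delta> x)) =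
          tensor_map id \<Delta> (\<Delta> x)"
    and counit_left: "x \<in> free_space B \<Longrightarrow>
          lin_ext (\<lambda>(a, b). smult (\<epsilon> (bvec a)) (bvec b)) (\<Delta> x) = x"
    and counit_right: "x \<in> free_space B \<Longrightarrow>
          lin_ext (\<lambda>(a, b). smult (\<epsilon> (bvec b)) (bvec a)) (\<Delta> x) = x"

locale k_bialgebra = k_coalgebra B \<Delta> \<epsilon> + k_algebra B mul u
  for B :: "'b set"
    and \<Delta> :: "('b \<Rightarrow>\<^sub>0 'k::field) \<Rightarrow> ('b \<times> 'b \<Rightarrow>\<^sub>0 'k)"
    and \<epsilon> :: "('b \<Rightarrow>\<^sub>0 'k) \<Rightarrow> 'k"
    and mul :: "('b \<Rightarrow>\<^sub>0 'k) \<Rightarrow> ('b \<Rightarrow>\<^sub>0 'k) \<Rightarrow> ('b \<Rightarrow>\<^sub>0 'k)"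
    and u :: "'b \<Rightarrow>\<^sub>0 'k" +
  assumes comult_mul: "\<lbrakk>x \<in> free_space B; y \<in> free_space B\<rbrakk> \<Longrightarrow>
          \<Delta> (mul x y) = tensor_mul mul (\<Delta> x) (\<Delta> y)"
    and comult_unit: "\<Delta> u = tensor u u"
    and counit_mul: "\<lbrakk>x \<in> free_space B; y \<in> free_space B\<rbrakk> \<Longrightarrow> \<epsilon> (mul x y) = \<epsilon> x * \<epsilon> y"
    and counit_unit: "\<epsilon> u = 1"

locale k_hopf_algebra = k_bialgebra B \<Delta> \<epsilon> mul u
  for B :: "'b set"
    and \<Delta> :: "('b \<Rightarrow>\<^sub>0 'k::field) \<Rightarrow> ('b \<times> 'b \<Rightarrow>\<^sub>0 'k)"
    and \<epsilon> :: "('b \<Rightarrow>\<^sub>0 'k) \<Rightarrow> 'k"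
    and mul :: "('b \<Rightarrow>\<^sub>0 'k) \<Rightarrow> ('b \<Rightarrow>\<^sub>0 'k) \<Rightarrow> ('b \<Rightarrow>\<^sub>0 'k)"
    and u :: "'b \<Rightarrow>\<^sub>0 'k"
    and S :: "('b \<Rightarrow>\<^sub>0 'k) \<Rightarrow> ('b \<Rightarrow>\<^sub>0 'k)" +
  assumes antipode_linear: "linear_map_on B B S"
    and antipode_left: "x \<in> free_space B \<Longrightarrow>
          lin_ext (\<lambda>(a, b). mul (S (bvec a)) (bvec b)) (\<Delta> x) = smult (\<epsilon> x) u"
    and antipode_right: "x \<in> free_space B \<Longrightarrow>
          lin_ext (\<lambda>(a, b). mul (bvec a) (S (bvec b))) (\<Delta> x) = smult (\<epsilon> x) u"


section \<open>The path coalgebra of a quiver\<close>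

text \<open>
  A quiver is a \<^locale>\<open>wf_digraph\<close>: a directed multigraph, loops and infinite vertex or arrow
  sets being allowed.  The path \<open>a\<^sub>n \<cdots> a\<^sub>1\<close> is represented by its source together with its
  arrows in the order in which they are traversed, \<open>(s(a\<^sub>1), [a\<^sub>1, \<dots>, a\<^sub>n])\<close>; thus \<open>(v, [])\<close> is
  the path of length 0 at the vertex \<open>v\<close>.
\<close>

type_synonym ('v, 'a) path = "'v \<times> 'a list"

definition paths :: "('v, 'a) pre_digraph \<Rightarrow> ('v, 'a) path set" where
  "paths Q = {(v, as) | v as. \<exists>w. pre_digraph.awalk Q v as w}"

definition paths_of_length :: "('v, 'a) pre_digraph \<Rightarrow> nat \<Rightarrow> ('v, 'a) path set" where
  "paths_of_length Q n = {(v, as) \<in> paths Q. length as = n}"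

definition path_target :: "('v, 'a) pre_digraph \<Rightarrow> ('v, 'a) path \<Rightarrow> 'v" where
  "path_target Q = (\<lambda>(v, as). last (pre_digraph.awalk_verts Q v as))"

text \<open>
  The summand for \<open>i\<close> splits off the first \<open>i\<close> arrows of the path: it is
  \<open>a\<^sub>n \<cdots> a\<^sub>i\<^sub>+\<^sub>1 \<otimes> a\<^sub>i \<cdots> a\<^sub>1\<close>, which is \<open>\<alpha> \<otimes> s(\<alpha>)\<close> for \<open>i = 0\<close> and \<open>t(\<alpha>) \<otimes> \<alpha>\<close> for \<open>i = n\<close>.
\<close>

definition path_comult ::
    "('v, 'a) pre_digraph \<Rightarrow> (('v, 'a) path \<Rightarrow>\<^sub>0 'k::field) \<Rightarrow>
     (('v, 'a) path \<times> ('v, 'a) path \<Rightarrow>\<^sub>0 'k)" where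
  "path_comult Q = lin_ext (\<lambda>(v, as). \<Sum>i\<le>length as.
     bvec ((path_target Q (v, take i as), drop i as), (v, take i as)))"

definition path_counit :: "(('v, 'a) path \<Rightarrow>\<^sub>0 'k::field) \<Rightarrow> 'k" where
  "path_counit x = (\<Sum>(v, as)\<in>Poly_Mapping.keys x.
     if as = [] then Poly_Mapping.lookup x (v, as) else 0)"

text \<open>
  Multiplication \<open>mul\<close>, unit \<open>u\<close> and antipode \<open>S\<close> making the path coalgebra \<open>kQ\<close> a Hopf
  algebra whose multiplication and unit respect the grading by path length.
\<close>

locale graded_hopf_structure =
  k_hopf_algebra "paths Q" "path_comult Q" path_counit mul u S
  for Q :: "('v, 'a) pre_digraph"
    and mul :: "(('v, 'a) path \<Rightarrow>\<^sub>0 'k::field) \<Rightarrow> (('v, 'a) path \<Rightarrow>\<^sub>0 'k) \<Rightarrow>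
                (('v, 'a) path \<Rightarrow>\<^sub>0 'k)"
    and u :: "('v, 'a) path \<Rightarrow>\<^sub>0 'k"
    and S :: "(('v, 'a) path \<Rightarrow>\<^sub>0 'k) \<Rightarrow> (('v, 'a) path \<Rightarrow>\<^sub>0 'k)" +
  assumes mul_graded:
      "\<lbrakk>x \<in> free_space (paths_of_length Q n); y \<in> free_space (paths_of_length Q m)\<rbrakk> \<Longrightarrow>
       mul x y \<in> free_space (paths_of_length Q (n + m))"
    and unit_graded: "u \<in> free_space (paths_of_length Q 0)"


section \<open>Hopf quivers\<close>

definition conj_class :: "('g, 'm) monoid_scheme \<Rightarrow> 'g \<Rightarrow> 'g set" where
  "conj_class G c = {g \<otimes>\<^bsub>G\<^esub> c \<otimes>\<^bsub>G\<^esub> inv\<^bsub>G\<^esub> g | g. g \<in> carrier G}"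

definition conj_classes :: "('g, 'm) monoid_scheme \<Rightarrow> 'g set set" where
  "conj_classes G = conj_class G ` carrier G"

text \<open>
  The formal sum of conjugacy classes with coefficients \<open>r\<^sub>C\<close> is the function \<open>C \<mapsto> r\<^sub>C\<close>,
  extended by 0 to sets that are not conjugacy classes.  Infinitely many coefficients may be
  nonzero, and the classes may be infinite.
\<close>

definition ramification_data :: "('g, 'm) monoid_scheme \<Rightarrow> ('g set \<Rightarrow> nat) \<Rightarrow> bool" where
  "ramification_data G r \<longleftrightarrow> (\<forall>C. C \<notin> conj_classes G \<longrightarrow> r C = 0)"

text \<open>The triples \<open>(x, c, i)\<close> with \<open>i < r\<^sub>C\<close> are the \<open>r\<^sub>C\<close> arrows from \<open>x\<close> to \<open>cx\<close>.\<close>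

definition hopf_quiver ::
    "('g, 'm) monoid_scheme \<Rightarrow> ('g set \<Rightarrow> nat) \<Rightarrow> ('g, 'g \<times> 'g \<times> nat) pre_digraph" where
  "hopf_quiver G r =
     \<lparr> verts = carrier G,
       arcs = {(x, c, i). x \<in> carrier G \<and> c \<in> carrier G \<and> i < r (conj_class G c)},
       tail = (\<lambda>(x, c, i). x),
       head = (\<lambda>(x, c, i). c \<otimes>\<^bsub>G\<^esub> x) \<rparr>"

end

theory Submission
  imports Defs
begin

text \<open>
  Suppose \<open>kQ\<close> is graded Hopf. Its group-likes of degree 0 are the vertices, so they form a group. An
  element of degree 1 with \<open>\<Delta> z = z \<otimes> x + y \<otimes> z\<close> is a combination of arrows \<open>x \<rightarrow> y\<close>, hence
  multiplication by a vertex on either side gives isomorphisms between spaces spanned by arrows, and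
  the number of arrows \<open>x \<rightarrow> y\<close> is invariant under left and right translation, i.e. depends only
  on the conjugacy class of \<open>y x\<^sup>-\<^sup>1\<close>.

  Conversely, on a Hopf quiver \<open>G\<close> permutes the arrows \<open>(x, c, i)\<close> by commuting actions
  \<open>g (x, c, i) = (g x, g c g\<^sup>-\<^sup>1, i)\<close> and \<open>(x, c, i) g = (x g, c, i)\<close>. The product of paths
  \<open>\<alpha> = a\<^sub>n \<cdots> a\<^sub>1\<close> and \<open>\<beta> = b\<^sub>m \<cdots> b\<^sub>1\<close> is the sum over all monotone lattice paths in the
  \<open>n \<times> m\<close> grid, a step of \<open>\<alpha>\<close> taken at the vertex \<open>y\<close> of \<open>\<beta>\<close> contributing the arrow \<open>a\<^sub>i y\<close>
  and a step of \<open>\<beta>\<close> taken at the vertex \<open>x\<close> of \<open>\<alpha>\<close> contributing \<open>x b\<^sub>j\<close>. Associativity compares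
  two ways of summing over lattice paths in a three-dimensional grid, compatibility with \<open>\<Delta>\<close>
  amounts to cutting a lattice path at one of its points, and the antipode reverses a path with a sign.
\<close>

section \<open>Linear maps on free spaces\<close>

lemma lookup_smult [simp]: "Poly_Mapping.lookup (smult c x) b = c * Poly_Mapping.lookup x b"
  by (simp add: smult_def Poly_Mapping.map.rep_eq when_def)

lemma lookup_bvec: "Poly_Mapping.lookup (bvec b :: 'b \<Rightarrow>\<^sub>0 'k::field) c = (if b = c then 1 else 0)"
  by (simp add: bvec_def lookup_single when_def)

lemma keys_bvec [simp]: "Poly_Mapping.keys (bvec b :: 'b \<Rightarrow>\<^sub>0 'k::field) = {b}"
  by (simp add: bvec_def)

lemma bvec_inject [simp]: "(bvec b :: 'b \<Rightarrow>\<^sub>0 'k::field) = bvec c \<longleftrightarrow> b = c"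
  by (metis keys_bvec singleton_inject)

lemma bvec_neq_0 [simp]: "(bvec b :: 'b \<Rightarrow>\<^sub>0 'k::field) \<noteq> 0"
  by (metis keys_bvec insert_not_empty keys_zero)

interpretation fs: vector_space "smult :: 'k::field \<Rightarrow> ('b \<Rightarrow>\<^sub>0 'k) \<Rightarrow> ('b \<Rightarrow>\<^sub>0 'k)"
  by unfold_locales (auto intro!: poly_mapping_eqI simp: lookup_add algebra_simps)

interpretation fsp: vector_space_pair
  "smult :: 'k::field \<Rightarrow> ('b \<Rightarrow>\<^sub>0 'k) \<Rightarrow> ('b \<Rightarrow>\<^sub>0 'k)"
  "smult :: 'k::field \<Rightarrow> ('c \<Rightarrow>\<^sub>0 'k) \<Rightarrow> ('c \<Rightarrow>\<^sub>0 'k)" ..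

text \<open>Linearity on the whole type, with no basis set attached: maps built by
  \<open>lin_ext\<close> have it, so a carrier such as \<open>paths Q\<close> enters only when two
  maps are compared on it.\<close>

abbreviation klin :: "(('b \<Rightarrow>\<^sub>0 'k::field) \<Rightarrow> ('c \<Rightarrow>\<^sub>0 'k)) \<Rightarrow> bool" where
  "klin \<equiv> Vector_Spaces.linear smult smult"

lemma klinI:
  assumes "\<And>x y. f (x + y) = f x + f y" "\<And>c x. f (smult c x) = smult c (f x)"
  shows "klin f"
  using assms by (intro Vector_Spaces.linear.intro fs.vector_space_axioms module_hom.intro module_hom_axioms.intro fs.module_axioms)

lemmas klin_add = fsp.linear_add and klin_scale = fsp.linear_scale
  and klin_sum = fsp.linear_sum

lemma poly_mapping_expand:
  "x = (\<Sum>b\<in>Poly_Mapping.keys x. smult (Poly_Mapping.lookup x b) (bvec b))"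
  by (intro poly_mapping_eqI) (auto simp: lookup_sum lookup_bvec if_distrib sum.delta in_keys_iff cong: if_cong)

text \<open>Identifies the carriers with spans in the library sense, which makes closure properties
  and the theory of linear independence available.\<close>

lemma free_space_eq_span: "(free_space B :: ('b \<Rightarrow>\<^sub>0 'k::field) set) = fs.span (bvec ` B)"
proof
  show "free_space B \<subseteq> fs.span (bvec ` B :: ('b \<Rightarrow>\<^sub>0 'k) set)"
  proof
    fix x :: "'b \<Rightarrow>\<^sub>0 'k" assume "x \<in> free_space B"
    then have "(\<Sum>b\<in>Poly_Mapping.keys x. smult (Poly_Mapping.lookup x b) (bvec b)) \<in> fs.span (bvec ` B)"
      by (intro fs.span_sum fs.span_scale fs.span_base) (auto simp: free_space_def)
    then show "x \<in> fs.span (bvec ` B)" by (simp flip: poly_mapping_expand)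
  qed
next
  have "fs.subspace (free_space B :: ('b \<Rightarrow>\<^sub>0 'k) set)"
    by (auto simp: fs.subspace_def free_space_def subset_iff in_keys_iff lookup_add)
       (metis add.left_neutral)
  then show "fs.span (bvec ` B) \<subseteq> (free_space B :: ('b \<Rightarrow>\<^sub>0 'k) set)"
    by (intro fs.span_minimal) (auto simp: free_space_def)
qed

lemma bvec_in_free_space [simp]: "(bvec b :: 'b \<Rightarrow>\<^sub>0 'k::field) \<in> free_space B \<longleftrightarrow> b \<in> B"
  by (simp add: free_space_def)

lemma free_space_add: "x \<in> free_space B \<Longrightarrow> y \<in> free_space B \<Longrightarrow> x + y \<in> free_space B"
  and free_space_smult: "x \<in> free_space B \<Longrightarrow> smult c x \<in> free_space B"
  and free_space_sum: "(\<And>i. i \<in> I \<Longrightarrow> h i \<in> free_space B) \<Longrightarrow> sum h I \<in> free_space B"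
  and free_space_0: "0 \<in> free_space B"
  unfolding free_space_eq_span by (auto intro: fs.span_add fs.span_scale fs.span_sum fs.span_zero)

lemma free_space_mono: "A \<subseteq> B \<Longrightarrow> free_space A \<subseteq> free_space B"
  by (auto simp: free_space_def)

text \<open>Reduction to basis vectors: a multilinear identity is proved by applying this once for
  each argument, until only paths remain.\<close>

lemma klin_eqI:
  assumes "klin f" "klin g" "x \<in> free_space B" "\<And>b. b \<in> B \<Longrightarrow> f (bvec b) = g (bvec b)"
  shows "f x = g x"
  using assms unfolding free_space_eq_span by (intro fsp.linear_eq_on[of f g x "bvec ` B"]) auto

text \<open>Coefficients may cancel in \<open>x + y\<close>, so the supports of \<open>x\<close>,
  \<open>y\<close> and \<open>x + y\<close> differ; a common finite superset makes the three sums
  comparable.\<close>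

lemma lin_ext_alt:
  assumes "finite A" "Poly_Mapping.keys x \<subseteq> A"
  shows "lin_ext f x = (\<Sum>b\<in>A. smult (Poly_Mapping.lookup x b) (f b))"
  unfolding lin_ext_def using assms
  by (intro sum.mono_neutral_left) (auto simp: in_keys_iff)

lemma klin_lin_ext:
  fixes f :: "'b \<Rightarrow> ('c \<Rightarrow>\<^sub>0 'k::field)"
  shows "klin (lin_ext f)"
proof (rule klinI)
  fix x y :: "'b \<Rightarrow>\<^sub>0 'k"
  let ?A = "Poly_Mapping.keys x \<union> Poly_Mapping.keys y"
  have *: "Poly_Mapping.keys (x + y) \<subseteq> ?A" using keys_add by fastforce
  show "lin_ext f (x + y) = lin_ext f x + lin_ext f y"
    using * by (simp add: lin_ext_alt[of ?A] lookup_add fs.scale_left_distrib sum.distrib)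
next
  fix c and x :: "'b \<Rightarrow>\<^sub>0 'k"
  have *: "Poly_Mapping.keys (smult c x) \<subseteq> Poly_Mapping.keys x" by (auto simp: in_keys_iff)
  show "lin_ext f (smult c x) = smult c (lin_ext f x)"
    using lin_ext_alt[OF _ *] by (simp add: lin_ext_def fs.scale_sum_right)
qed

lemma lin_ext_bvec [simp]: "lin_ext f (bvec b) = f b"
  by (simp add: lin_ext_def lookup_bvec)

lemma lin_ext_add_fun: "lin_ext (\<lambda>b. f b + g b) x = lin_ext f x + lin_ext g x"
  by (simp add: lin_ext_def fs.scale_right_distrib sum.distrib)

lemma lin_ext_smult_fun: "lin_ext (\<lambda>b. smult c (f b)) x = smult c (lin_ext f x)"
  by (simp add: lin_ext_def fs.scale_sum_right mult.commute)

lemma klin_lin_ext_fun: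
  assumes "\<And>b. klin (f b)"
  shows "klin (\<lambda>y. lin_ext (\<lambda>b. f b y) x)"
  using assms by (intro klinI) (simp_all add: klin_add klin_scale lin_ext_add_fun lin_ext_smult_fun)

lemma klin_compose: "klin f \<Longrightarrow> klin g \<Longrightarrow> klin (\<lambda>x. f (g x))"
  using Vector_Spaces.linear_compose[of smult smult g smult f] by (simp add: o_def)

lemma klin_ident: "klin (\<lambda>x. x)"
  by (intro klinI) auto

lemma klin_eq_lin_ext: "klin f \<Longrightarrow> f x = lin_ext (\<lambda>b. f (bvec b)) x"
  by (rule klin_eqI[where B = UNIV]) (auto intro: klin_lin_ext simp: free_space_def)

lemma lin_ext_in_free_space:
  "x \<in> free_space B \<Longrightarrow> (\<And>b. b \<in> B \<Longrightarrow> f b \<in> free_space C) \<Longrightarrow> lin_ext f x \<in> free_space C"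
  unfolding lin_ext_def by (intro free_space_sum free_space_smult) (auto simp: free_space_def)

lemma linear_map_on_klin:
  assumes "klin f" "\<And>b. b \<in> B \<Longrightarrow> f (bvec b) \<in> free_space C"
  shows "linear_map_on B C f"
proof -
  have "f x \<in> free_space C" if "x \<in> free_space B" for x
    using lin_ext_in_free_space[OF that, of "\<lambda>b. f (bvec b)" C] assms klin_eq_lin_ext[OF assms(1), of x]
    by simp
  then show ?thesis
    using assms(1) by (auto simp: linear_map_on_def klin_add klin_scale)
qed

text \<open>The operations of an abstract Hopf algebra are constrained only on
  \<open>free_space B\<close>; there they can be replaced by a map that is linear
  everywhere.\<close>

lemma linear_map_on_eq_lin_ext:
  assumes "linear_map_on B C f" "x \<in> free_space B"
  shows "f x = lin_ext (\<lambda>b. f (bvec b)) x"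
proof -
  have f0: "f 0 = 0"
    using assms(1) unfolding linear_map_on_def by (metis add_cancel_right_right free_space_0)
  have sum: "finite I \<Longrightarrow> (\<And>i. i \<in> I \<Longrightarrow> h i \<in> free_space B) \<Longrightarrow> f (sum h I) = (\<Sum>i\<in>I. f (h i))" for h I
    by (induction I rule: finite_induct)
      (use f0 assms(1) in \<open>auto simp: linear_map_on_def free_space_sum\<close>)
  have b: "b \<in> Poly_Mapping.keys x \<Longrightarrow> b \<in> B" for b
    using assms(2) by (auto simp: free_space_def)
  have "f x = f (\<Sum>b\<in>Poly_Mapping.keys x. smult (Poly_Mapping.lookup x b) (bvec b))"
    by (simp flip: poly_mapping_expand)
  also have "\<dots> = lin_ext (\<lambda>b. f (bvec b)) x"
    using b assms(1) by (subst sum) (auto simp: lin_ext_def linear_map_on_def intro!: free_space_smult)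
  finally show ?thesis .
qed

section \<open>Tensor products in coordinates\<close>

lemma klin_tensor_left: "klin (\<lambda>x. tensor x y)"
  unfolding tensor_def by (rule klin_lin_ext)

lemma klin_tensor_right: "klin (tensor x)"
  unfolding tensor_def by (rule klin_lin_ext_fun) (rule klin_lin_ext)

lemma tensor_bvec [simp]: "tensor (bvec a) (bvec b) = bvec (a, b)"
  by (simp add: tensor_def)

lemma lookup_lin_ext:
  "Poly_Mapping.lookup (lin_ext f x) c =
     (\<Sum>b\<in>Poly_Mapping.keys x. Poly_Mapping.lookup x b * Poly_Mapping.lookup (f b) c)"
  by (simp add: lin_ext_def lookup_sum)

lemma lookup_tensor [simp]:
  "Poly_Mapping.lookup (tensor x y) (b, c) = Poly_Mapping.lookup x b * Poly_Mapping.lookup y c"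
proof -
  have "Poly_Mapping.lookup (lin_ext (\<lambda>c'. bvec (b', c')) y) (b, c) =
      (if b' = b then Poly_Mapping.lookup y c else 0)" for b'
    by (auto simp: lookup_lin_ext lookup_bvec if_distrib sum.delta in_keys_iff cong: if_cong)
  note this [simp]
  show ?thesis
    by (simp add: tensor_def lookup_lin_ext[of "\<lambda>b. lin_ext (\<lambda>c. bvec (b, c)) y"] if_distrib sum.delta in_keys_iff cong: if_cong)
qed

lemma tensor_map_bvec [simp]:
  "tensor_map f g (bvec (a, b)) = tensor (f (bvec a)) (g (bvec b))"
  by (simp add: tensor_map_def)

lemma klin_tensor_map: "klin (tensor_map f g)"
  unfolding tensor_map_def by (rule klin_lin_ext)

lemma tensor_mul_bvec [simp]:
  "tensor_mul m (bvec (a, b)) (bvec (c, d)) = tensor (m (bvec a) (bvec c)) (m (bvec b) (bvec d))"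
  by (simp add: tensor_mul_def)

lemma klin_tensor_mul_left: "klin (\<lambda>X. tensor_mul m X Y)"
  unfolding tensor_mul_def by (rule klin_lin_ext)

lemma klin_tensor_mul_right: "klin (tensor_mul m X)"
  unfolding tensor_mul_def by (rule klin_lin_ext_fun) (auto intro: klin_lin_ext split: prod.split)

section \<open>Independence of the basis and comparison of dimensions\<close>

lemma independent_bvec: "\<not> fs.dependent (bvec ` B)"
proof
  assume "fs.dependent (bvec ` B :: ('b \<Rightarrow>\<^sub>0 'a) set)"
  then obtain b where b: "b \<in> B" "(bvec b :: 'b \<Rightarrow>\<^sub>0 'a) \<in> fs.span (bvec ` B - {bvec b})"
    by (auto simp: fs.dependent_def)
  have "bvec ` B - {bvec b} = (bvec ` (B - {b}) :: ('b \<Rightarrow>\<^sub>0 'a) set)" by auto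
  with b(2) show False by (simp flip: free_space_eq_span)
qed

text \<open>An injective map keeps the image of the basis \<open>A\<close> independent, and that
  image lies in a space spanned by finitely many vectors, so the exchange bound applies.\<close>

lemma card_le_of_injective:
  fixes f :: "('b \<Rightarrow>\<^sub>0 'k::field) \<Rightarrow> ('c \<Rightarrow>\<^sub>0 'k)"
  assumes "linear_map_on A C f" "inj_on f (free_space A)" "finite C"
  shows "card A \<le> card C"
proof -
  let ?g = "lin_ext (\<lambda>b. f (bvec b))"
  have eq: "x \<in> free_space A \<Longrightarrow> f x = ?g x" for x
    using linear_map_on_eq_lin_ext[OF assms(1)] .
  have inj: "inj_on ?g (fs.span (bvec ` A))"
    using assms(2) eq by (auto simp: inj_on_def free_space_eq_span)
  have "\<not> fs.dependent (?g ` bvec ` A)"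
    by (rule fsp.linear_independent_injective_image[OF klin_lin_ext independent_bvec inj])
  moreover have "?g ` bvec ` A \<subseteq> fs.span (bvec ` C)"
    using assms(1) by (auto simp: linear_map_on_def Pi_iff simp flip: free_space_eq_span)
  ultimately have "card (?g ` bvec ` A) \<le> card (bvec ` C :: ('c \<Rightarrow>\<^sub>0 'k) set)"
    using fs.independent_span_bound assms(3) by blast
  moreover have "card (?g ` bvec ` A) = card A"
    using inj_on_subset[OF inj fs.span_superset]
    by (subst card_image) (auto simp: card_image inj_on_def)
  moreover have "card (bvec ` C :: ('c \<Rightarrow>\<^sub>0 'k) set) = card C"
    by (auto simp: card_image inj_on_def)
  ultimately show ?thesis by simp
qed

lemma linear_map_on_subset:
  assumes "linear_map_on B C f" "A \<subseteq> B" "\<And>x. x \<in> free_space A \<Longrightarrow> f x \<in> free_space D"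
  shows "linear_map_on A D f"
  using assms(1,3) free_space_mono[OF assms(2)] unfolding linear_map_on_def subset_iff by blast

text \<open>Each \<open>c i\<close> with \<open>i < n\<close> occurs in the terms \<open>i\<close>
  and \<open>i + 1\<close>, with opposite signs. This is the cancellation behind both antipode
  axioms.\<close>

lemma alternating_telescope:
  fixes c :: "nat \<Rightarrow> ('b \<Rightarrow>\<^sub>0 'k::field)"
  assumes "n > 0"
  shows "(\<Sum>i\<le>n. smult ((-1) ^ i) ((if i < n then c i else 0) + (if i > 0 then c (i - 1) else 0))) = 0"
proof -
  \<comment> \<open>The partial sum up to \<open>m\<close> leaves \<open>c m\<close> uncancelled;
    the term for \<open>i = n\<close> contains only \<open>c (n - 1)\<close> and removes the
    remainder.\<close>
  have *: "m < n \<Longrightarrow> (\<Sum>i\<le>m. smult ((-1) ^ i) ((if i < n then c i else 0) + (if i > 0 then c (i - 1) else 0)))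
        = smult ((-1) ^ m) (c m)" for m
    by (induction m) (simp_all add: fs.scale_right_distrib flip: fs.scale_left_distrib)
  obtain m where "n = Suc m" using assms by (cases n) auto
  then show ?thesis using *[of m] by (simp flip: fs.scale_left_distrib)
qed

section \<open>The path coalgebra\<close>

abbreviation (in pre_digraph) tgt :: "'a \<Rightarrow> 'b list \<Rightarrow> 'a" where
  "tgt v as \<equiv> path_target G (v, as)"

context pre_digraph begin

lemma tgt_Nil [simp]: "tgt v [] = v"
  by (simp add: path_target_def)

lemma tgt_Cons [simp]: "tgt v (a # as) = tgt (head G a) as"
  by (cases as) (simp_all add: path_target_def)

lemma tgt_append [simp]: "tgt v (as @ bs) = tgt (tgt v as) bs"
  by (induction as arbitrary: v) simp_all

end

context wf_digraph begin

lemma path_Nil [simp]: "(v, []) \<in> paths G \<longleftrightarrow> v \<in> verts G"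
  by (auto simp: paths_def awalk_def)

lemma path_Cons [simp]:
  "(v, a # as) \<in> paths G \<longleftrightarrow> a \<in> arcs G \<and> tail G a = v \<and> (head G a, as) \<in> paths G"
  by (auto simp: paths_def awalk_def)

lemma path_source: "(v, as) \<in> paths G \<Longrightarrow> v \<in> verts G"
  by (cases as) auto

lemma path_append [simp]:
  "(v, as @ bs) \<in> paths G \<longleftrightarrow> (v, as) \<in> paths G \<and> (tgt v as, bs) \<in> paths G"
  by (induction as arbitrary: v) (auto dest: path_source)

lemma path_target_in_verts: "(v, as) \<in> paths G \<Longrightarrow> tgt v as \<in> verts G"
  by (induction as arbitrary: v) auto

end

section \<open>Sums over the cuts of a path\<close>

context pre_digraph begin

text \<open>
  \<open>splits v as F\<close> is the sum of \<open>F t d k\<close> over the factorisations \<open>as = k @ d\<close>, \<open>t\<close> being the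
  vertex at which the path from \<open>v\<close> is cut.
\<close>

fun splits :: "'a \<Rightarrow> 'b list \<Rightarrow> ('a \<Rightarrow> 'b list \<Rightarrow> 'b list \<Rightarrow> 'm::comm_monoid_add) \<Rightarrow> 'm" where
  "splits v [] F = F v [] []"
| "splits v (a # as) F = F v (a # as) [] + splits (head G a) as (\<lambda>t d k. F t d (a # k))"

lemma splits_eq_sum: "splits v as F = (\<Sum>i\<le>length as. F (tgt v (take i as)) (drop i as) (take i as))"
  by (induction as arbitrary: v F) (simp_all add: sum.atMost_Suc_shift del: sum.atMost_Suc)

lemma path_comult_bvec: "path_comult G (bvec (v, as)) = splits v as (\<lambda>t d k. bvec ((t, d), (v, k)))"
  by (simp add: path_comult_def splits_eq_sum)

lemma splits_add: "splits v as (\<lambda>t d k. F t d k + F' t d k) = splits v as F + splits v as F'"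
  by (simp add: splits_eq_sum sum.distrib)

lemma klin_splits: "klin f \<Longrightarrow> f (splits v as F) = splits v as (\<lambda>t d k. f (F t d k))"
  by (simp add: splits_eq_sum klin_sum)

text \<open>Both sides sum over the factorisations of the path into three consecutive
  pieces.\<close>

lemma splits_coassoc:
  "splits v as (\<lambda>t d k. splits t d (\<lambda>t' d' k'. F t' d' t k' k)) =
   splits v as (\<lambda>t d k. splits v k (\<lambda>t' d' k'. F t d t' d' k'))"
  by (induction as arbitrary: v F) (simp_all add: splits_add add.assoc)

lemma splits_zero [simp]: "splits v as (\<lambda>t d k. 0) = 0"
  by (simp add: splits_eq_sum)

text \<open>The counit kills every path of positive length, so in each counit axiom only the cut at
  one end survives.\<close>

lemma splits_trivial_right: "splits v as (\<lambda>t d k. if k = [] then F t d else 0) = F v as"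
  by (cases as) simp_all

lemma splits_trivial_left: "splits v as (\<lambda>t d k. if d = [] then F k else 0) = F as"
  by (induction as arbitrary: v F) simp_all

end

text \<open>A scalar is encoded as a vector over the one-element basis \<open>()\<close>, so that
  linearity of the counit is inherited from \<open>lin_ext\<close>.\<close>

lemma path_counit_eq:
  "path_counit x = Poly_Mapping.lookup (lin_ext (\<lambda>(v, as). if as = [] then bvec () else 0) x) ()"
  unfolding path_counit_def lookup_lin_ext by (intro sum.cong) (auto simp: lookup_bvec)

lemma path_counit_add: "path_counit (x + y) = path_counit x + path_counit y"
  by (simp add: path_counit_eq klin_add[OF klin_lin_ext] lookup_add)

lemma path_counit_smult: "path_counit (smult c x) = c * path_counit x"
  by (simp add: path_counit_eq klin_scale[OF klin_lin_ext])

lemma path_counit_bvec [simp]: "path_counit (bvec (v, as)) = (if as = [] then 1 else 0)"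
  by (simp add: path_counit_eq lookup_bvec)

text \<open>Multiplying a fixed vector by the counit turns a scalar-valued form into a linear map,
  to which \<open>klin_eqI\<close> applies.\<close>

lemma klin_path_counit: "klin (\<lambda>x. smult (path_counit x) y)"
  by (intro klinI) (simp_all add: path_counit_add path_counit_smult fs.scale_left_distrib)

lemma klin_path_comult: "klin (path_comult Q)"
  unfolding path_comult_def by (rule klin_lin_ext)

lemma (in wf_digraph) path_coalgebra:
  "k_coalgebra (paths G) (path_comult G) (path_counit :: (('a, 'b) path \<Rightarrow>\<^sub>0 'k::field) \<Rightarrow> 'k)"
proof
  have split: "splits v as (\<lambda>t d k. bvec ((t, d), (v, k))) \<in> free_space (paths G \<times> paths G)"
    if "(v, as) \<in> paths G" for v as
    unfolding splits_eq_sum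
  proof (intro free_space_sum)
    fix i
    \<comment> \<open>Kept as an explicit concatenation so that \<open>path_append\<close> yields
      both halves as paths.\<close>
    have "(v, take i as @ drop i as) \<in> paths G" using that by simp
    then show "bvec ((tgt v (take i as), drop i as), (v, take i as)) \<in> free_space (paths G \<times> paths G)"
      unfolding path_append by simp
  qed
  show "linear_map_on (paths G) (paths G \<times> paths G) (path_comult G)"
    by (rule linear_map_on_klin[OF klin_path_comult]) (auto simp: path_comult_bvec split)
  show "linear_form_on (paths G) path_counit"
    by (simp add: linear_form_on_def path_counit_add path_counit_smult)
next
  fix x :: "('a, 'b) path \<Rightarrow>\<^sub>0 'k" assume x: "x \<in> free_space (paths G)"
  show "lin_ext (\<lambda>((a, b), c). bvec (a, (b, c))) (tensor_map (path_comult G) id (path_comult G x)) =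
        tensor_map id (path_comult G) (path_comult G x)"
    by (rule klin_eqI[OF _ _ x])
      (auto intro!: klin_compose[OF klin_lin_ext] klin_compose[OF klin_tensor_map] klin_path_comult
        simp: path_comult_bvec klin_splits[OF klin_tensor_map] klin_splits[OF klin_lin_ext]
          klin_splits[OF klin_tensor_left] klin_splits[OF klin_tensor_right] splits_coassoc)
  show "lin_ext (\<lambda>(a, b). smult (path_counit (bvec a)) (bvec b)) (path_comult G x) = x"
    by (rule klin_eqI[OF _ klin_ident x])
      (auto intro!: klin_compose[OF klin_lin_ext] klin_path_comult
        simp: path_comult_bvec klin_splits[OF klin_lin_ext] splits_trivial_left if_distrib[of "\<lambda>c. smult c _"] cong: if_cong)
  show "lin_ext (\<lambda>(a, b). smult (path_counit (bvec b)) (bvec a)) (path_comult G x) = x"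
    by (rule klin_eqI[OF _ klin_ident x])
      (auto intro!: klin_compose[OF klin_lin_ext] klin_path_comult
        simp: path_comult_bvec klin_splits[OF klin_lin_ext] splits_trivial_right if_distrib[of "\<lambda>c. smult c _"] cong: if_cong)
qed

section \<open>The shuffle product of a quiver with commuting group actions\<close>

text \<open>Isolates what the shuffle construction uses of a Hopf quiver: a group on the vertices,
  and two commuting actions on arrows lying over left and right translation. No coordinates
  \<open>(x, c, i)\<close> occur.\<close>

locale biaction_quiver = wf_digraph Q + group H
  for Q :: "('v, 'a) pre_digraph" and H :: "'v monoid" (structure) +
  fixes L :: "'v \<Rightarrow> 'a \<Rightarrow> 'a" and R :: "'a \<Rightarrow> 'v \<Rightarrow> 'a"
  assumes carrier_eq: "carrier H = verts Q"
    and L_arc: "\<lbrakk>g \<in> verts Q; a \<in> arcs Q\<rbrakk> \<Longrightarrow> L g a \<in> arcs Q"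
    and L_tail: "\<lbrakk>g \<in> verts Q; a \<in> arcs Q\<rbrakk> \<Longrightarrow> tail Q (L g a) = g \<otimes> tail Q a"
    and L_head: "\<lbrakk>g \<in> verts Q; a \<in> arcs Q\<rbrakk> \<Longrightarrow> head Q (L g a) = g \<otimes> head Q a"
    and L_one: "a \<in> arcs Q \<Longrightarrow> L \<one> a = a"
    and L_mult: "\<lbrakk>g \<in> verts Q; h \<in> verts Q; a \<in> arcs Q\<rbrakk> \<Longrightarrow> L (g \<otimes> h) a = L g (L h a)"
    and R_arc: "\<lbrakk>g \<in> verts Q; a \<in> arcs Q\<rbrakk> \<Longrightarrow> R a g \<in> arcs Q"
    and R_tail: "\<lbrakk>g \<in> verts Q; a \<in> arcs Q\<rbrakk> \<Longrightarrow> tail Q (R a g) = tail Q a \<otimes> g"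
    and R_head: "\<lbrakk>g \<in> verts Q; a \<in> arcs Q\<rbrakk> \<Longrightarrow> head Q (R a g) = head Q a \<otimes> g"
    and R_one: "a \<in> arcs Q \<Longrightarrow> R a \<one> = a"
    and R_mult: "\<lbrakk>g \<in> verts Q; h \<in> verts Q; a \<in> arcs Q\<rbrakk> \<Longrightarrow> R a (g \<otimes> h) = R (R a g) h"
    and L_R: "\<lbrakk>g \<in> verts Q; h \<in> verts Q; a \<in> arcs Q\<rbrakk> \<Longrightarrow> L g (R a h) = R (L g a) h"
begin

lemmas action_simps [simp] = L_arc L_tail L_head L_one R_arc R_tail R_head R_one

lemma vert_closed [simp]:
  "x \<in> verts Q \<Longrightarrow> y \<in> verts Q \<Longrightarrow> x \<otimes> y \<in> verts Q"
  "\<one> \<in> verts Q"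
  "x \<in> verts Q \<Longrightarrow> inv x \<in> verts Q"
  by (simp_all flip: carrier_eq)

lemma vert_assoc: "\<lbrakk>x \<in> verts Q; y \<in> verts Q; z \<in> verts Q\<rbrakk> \<Longrightarrow> x \<otimes> y \<otimes> z = x \<otimes> (y \<otimes> z)"
  by (simp add: m_assoc flip: carrier_eq)

lemma vert_simps [simp]:
  "x \<in> verts Q \<Longrightarrow> \<one> \<otimes> x = x"
  "x \<in> verts Q \<Longrightarrow> x \<otimes> \<one> = x"
  "x \<in> verts Q \<Longrightarrow> inv x \<otimes> x = \<one>"
  "x \<in> verts Q \<Longrightarrow> x \<otimes> inv x = \<one>"
  "x \<in> verts Q \<Longrightarrow> inv (inv x) = x"
  by (simp_all flip: carrier_eq)

text \<open>
  \<open>shuffles x as y bs F\<close> is the sum of \<open>F w\<close> over the lattice paths \<open>w\<close> in the grid of the paths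
  \<open>(x, as)\<close> and \<open>(y, bs)\<close>. Summing an arbitrary \<open>F\<close> instead of forming the linear combination of
  the \<open>w\<close> makes products of several factors plain nestings.
\<close>

fun shuffles :: "'v \<Rightarrow> 'a list \<Rightarrow> 'v \<Rightarrow> 'a list \<Rightarrow> ('a list \<Rightarrow> 'm::comm_monoid_add) \<Rightarrow> 'm" where
  "shuffles x [] y [] F = F []"
| "shuffles x (a # as) y [] F = shuffles (head Q a) as y [] (\<lambda>w. F (R a y # w))"
| "shuffles x [] y (b # bs) F = shuffles x [] (head Q b) bs (\<lambda>w. F (L x b # w))"
| "shuffles x (a # as) y (b # bs) F =
     shuffles (head Q a) as y (b # bs) (\<lambda>w. F (R a y # w)) +
     shuffles x (a # as) (head Q b) bs (\<lambda>w. F (L x b # w))"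

text \<open>Follows the recursion of \<open>shuffles\<close> but leaves out the summand
  \<open>F\<close>, which changes in recursive calls and so can be generalised in each
  induction.\<close>

lemma shuffles_induct [case_names Nil_Nil Cons_Nil Nil_Cons Cons_Cons]:
  assumes "\<And>x y. P x [] y []"
    and "\<And>x a as y. P (head Q a) as y [] \<Longrightarrow> P x (a # as) y []"
    and "\<And>x y b bs. P x [] (head Q b) bs \<Longrightarrow> P x [] y (b # bs)"
    and "\<And>x a as y b bs. P (head Q a) as y (b # bs) \<Longrightarrow> P x (a # as) (head Q b) bs \<Longrightarrow>
           P x (a # as) y (b # bs)"
  shows "P x as y bs"
  using assms by induction_schema (pat_completeness, lexicographic_order)

lemma shuffles_add: "shuffles x as y bs (\<lambda>w. F w + F' w) = shuffles x as y bs F + shuffles x as y bs F'"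
  by (induction x as y bs arbitrary: F F' rule: shuffles_induct) (simp_all add: algebra_simps)

lemma shuffles_zero [simp]: "shuffles x as y bs (\<lambda>w. 0) = 0"
  by (induction x as y bs rule: shuffles_induct) simp_all

lemma klin_shuffles: "klin f \<Longrightarrow> f (shuffles x as y bs F) = shuffles x as y bs (\<lambda>w. f (F w))"
  by (induction x as y bs arbitrary: F rule: shuffles_induct) (simp_all add: klin_add)

text \<open>The first step of a lattice path leads from \<open>x \<otimes> y\<close> to the product
  vertex at which the remaining grid starts, so the arrows compose. Each arrow of both sides is used
  once, which gives the grading.\<close>

lemma shuffles_in_free_space:
  assumes "(x, as) \<in> paths Q" "(y, bs) \<in> paths Q"
    and "\<And>w. (x \<otimes> y, w) \<in> paths Q \<Longrightarrow> length w = length as + length bs \<Longrightarrow> F w \<in> free_space B"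
  shows "shuffles x as y bs F \<in> free_space B"
  using assms
  by (induction x as y bs arbitrary: F rule: shuffles_induct) (auto intro!: free_space_add dest: path_source)

lemma shuffles_one_left: "(y, bs) \<in> paths Q \<Longrightarrow> shuffles \<one> [] y bs F = F bs"
  by (induction bs arbitrary: y F) simp_all

lemma shuffles_one_right: "(x, as) \<in> paths Q \<Longrightarrow> shuffles x as \<one> [] F = F as"
  by (induction as arbitrary: x F) simp_all

text \<open>Induction over boxes with three side lengths: the step case moves along one side, and a
  box with an empty side is left to the two-dimensional \<open>shuffles_induct\<close>.\<close>

lemma shuffles_assoc_induct [case_names Nil1 Nil2 Nil3 Cons]:
  assumes "\<And>x y bs z cs. P x [] y bs z cs"
    and "\<And>x as y z cs. P x as y [] z cs"
    and "\<And>x as y bs z. P x as y bs z []"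
    and "\<And>x a as y b bs z c cs. P (head Q a) as y (b # bs) z (c # cs) \<Longrightarrow>
           P x (a # as) (head Q b) bs z (c # cs) \<Longrightarrow> P x (a # as) y (b # bs) (head Q c) cs \<Longrightarrow>
           P x (a # as) y (b # bs) z (c # cs)"
  shows "P x as y bs z cs"
proof (induction "length as + length bs + length cs" arbitrary: x as y bs z cs rule: less_induct)
  case less
  show ?case
  proof (cases "as = [] \<or> bs = [] \<or> cs = []")
    case True
    then show ?thesis using assms(1-3) by auto
  next
    case False
    then obtain a as' b bs' c cs' where eq: "as = a # as'" "bs = b # bs'" "cs = c # cs'"
      by (auto simp: neq_Nil_conv)
    show ?thesis unfolding eq by (rule assms(4); rule less; simp add: eq)
  qed
qed

text \<open>Both bracketings are sorted by the factor that makes the first step in the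
  three-dimensional grid.\<close>

lemma shuffles_assoc:
  assumes "(x, as) \<in> paths Q" "(y, bs) \<in> paths Q" "(z, cs) \<in> paths Q"
  shows "shuffles x as y bs (\<lambda>w. shuffles (x \<otimes> y) w z cs F) =
         shuffles y bs z cs (\<lambda>w. shuffles x as (y \<otimes> z) w F)"
  using assms
proof (induction x as y bs z cs arbitrary: F rule: shuffles_assoc_induct)
  case (Nil1 x y bs z cs)
  then show ?case
    by (induction y bs z cs arbitrary: F rule: shuffles_induct)
       (simp_all add: L_mult L_R vert_assoc shuffles_add path_source)
next
  case (Nil2 x as y z cs)
  then show ?case
    by (induction x as z cs arbitrary: F rule: shuffles_induct)
       (simp_all add: L_mult R_mult vert_assoc shuffles_add path_source)
next
  case (Nil3 x as y bs z)
  then show ?case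
    by (induction x as y bs arbitrary: F rule: shuffles_induct)
       (simp_all add: R_mult L_R vert_assoc shuffles_add path_source)
next
  case (Cons x a as y b bs z c cs)
  let ?A = "a # as" and ?B = "b # bs" and ?C = "c # cs"
  have P: "x \<in> verts Q" "y \<in> verts Q" "z \<in> verts Q" "a \<in> arcs Q" "b \<in> arcs Q" "c \<in> arcs Q"
    using Cons.prems by auto
  \<comment> \<open>First steps along \<open>?C\<close> appear once for each choice of the first
    arrow of \<open>w\<close>; the two groups recombine into the third summand.
    \<open>R_mult\<close> and \<open>L_R\<close> bring the other two arrows into a form independent
    of the bracketing.\<close>
  have "shuffles x ?A y ?B (\<lambda>w. shuffles (x \<otimes> y) w z ?C F) =
      shuffles (head Q a) as y ?B (\<lambda>w. shuffles (head Q a \<otimes> y) w z ?C (\<lambda>w. F (R a (y \<otimes> z) # w))) +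
      shuffles x ?A (head Q b) bs (\<lambda>w. shuffles (x \<otimes> head Q b) w z ?C (\<lambda>w. F (L x (R b z) # w))) +
      shuffles x ?A y ?B (\<lambda>w. shuffles (x \<otimes> y) w (head Q c) cs (\<lambda>w. F (L (x \<otimes> y) c # w)))"
    using P by (simp add: shuffles_add R_mult L_R algebra_simps)
  also have "\<dots> =
      shuffles y ?B z ?C (\<lambda>w. shuffles (head Q a) as (y \<otimes> z) w (\<lambda>w. F (R a (y \<otimes> z) # w))) +
      shuffles (head Q b) bs z ?C (\<lambda>w. shuffles x ?A (head Q b \<otimes> z) w (\<lambda>w. F (L x (R b z) # w))) +
      shuffles y ?B (head Q c) cs (\<lambda>w. shuffles x ?A (y \<otimes> head Q c) w (\<lambda>w. F (L (x \<otimes> y) c # w)))"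
    using Cons by simp
  also have "\<dots> = shuffles y ?B z ?C (\<lambda>w. shuffles x ?A (y \<otimes> z) w F)"
    using P by (simp add: shuffles_add L_mult algebra_simps)
  finally show ?case .
qed

text \<open>A lattice path with a marked point is a cut of each factor, together with one lattice
  path in the grid before the point and one in the grid after it.\<close>

lemma shuffles_splits:
  assumes "(x, as) \<in> paths Q" "(y, bs) \<in> paths Q"
  shows "shuffles x as y bs (\<lambda>w. splits (x \<otimes> y) w F) =
    splits x as (\<lambda>x' d k. splits y bs (\<lambda>y' d' k'.
      shuffles x' d y' d' (\<lambda>w. shuffles x k y k' (\<lambda>w'. F (x' \<otimes> y') w w'))))"
  using assms
  by (induction x as y bs arbitrary: F rule: shuffles_induct)
     (simp_all add: shuffles_add splits_add path_source ac_simps)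

text \<open>Recursion on the last step instead of the first; in the left antipode axiom the
  cancellation happens at the end of lattice paths.\<close>

lemma shuffles_snoc:
  "shuffles x as y bs F =
    (if as = [] \<and> bs = [] then F []
     else (if as \<noteq> [] then shuffles x (butlast as) y bs (\<lambda>w. F (w @ [R (last as) (tgt y bs)])) else 0) +
          (if bs \<noteq> [] then shuffles x as y (butlast bs) (\<lambda>w. F (w @ [L (tgt x as) (last bs)])) else 0))"
  by (induction x as y bs arbitrary: F rule: shuffles_induct) (auto simp: ac_simps)

lemma vert_cancel [simp]:
  "x \<in> verts Q \<Longrightarrow> y \<in> verts Q \<Longrightarrow> inv x \<otimes> (x \<otimes> y) = y"
  "x \<in> verts Q \<Longrightarrow> y \<in> verts Q \<Longrightarrow> x \<otimes> (inv x \<otimes> y) = y"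
  by (simp_all flip: vert_assoc)

section \<open>The product on basis paths and its grading\<close>

definition shuffle_mul :: "(('v, 'a) path \<Rightarrow>\<^sub>0 'k::field) \<Rightarrow> (('v, 'a) path \<Rightarrow>\<^sub>0 'k) \<Rightarrow> (('v, 'a) path \<Rightarrow>\<^sub>0 'k)" where
  "shuffle_mul X Y =
     lin_ext (\<lambda>(x, as). lin_ext (\<lambda>(y, bs). shuffles x as y bs (\<lambda>w. bvec (x \<otimes> y, w))) Y) X"

lemma shuffle_mul_bvec:
  "shuffle_mul (bvec (x, as)) (bvec (y, bs)) = shuffles x as y bs (\<lambda>w. bvec (x \<otimes> y, w))"
  by (simp add: shuffle_mul_def)

lemma klin_shuffle_mul_left: "klin (\<lambda>X. shuffle_mul X Y)"
  unfolding shuffle_mul_def by (rule klin_lin_ext)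

lemma klin_shuffle_mul_right: "klin (shuffle_mul X)"
  unfolding shuffle_mul_def
  by (rule klin_lin_ext_fun) (auto intro: klin_lin_ext split: prod.split)

lemma shuffle_mul_graded:
  assumes "X \<in> free_space (paths_of_length Q n)" "Y \<in> free_space (paths_of_length Q m)"
  shows "shuffle_mul X Y \<in> free_space (paths_of_length Q (n + m))"
  unfolding shuffle_mul_def
  by (rule lin_ext_in_free_space[OF assms(1)], clarify, rule lin_ext_in_free_space[OF assms(2)], clarify,
      rule shuffles_in_free_space) (auto simp: paths_of_length_def)

lemma shuffle_mul_closed:
  assumes "X \<in> free_space (paths Q)" "Y \<in> free_space (paths Q)"
  shows "shuffle_mul X Y \<in> free_space (paths Q)"
  unfolding shuffle_mul_def
  by (rule lin_ext_in_free_space[OF assms(1)], clarify, rule lin_ext_in_free_space[OF assms(2)], clarify,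
      rule shuffles_in_free_space) auto

section \<open>The antipode\<close>

fun reversal :: "'v \<Rightarrow> 'a list \<Rightarrow> 'a list" where
  "reversal x [] = []"
| "reversal x (a # as) = reversal (head Q a) as @ [L (inv (head Q a)) (R a (inv x))]"

definition antipode :: "(('v, 'a) path \<Rightarrow>\<^sub>0 'k::field) \<Rightarrow> (('v, 'a) path \<Rightarrow>\<^sub>0 'k)" where
  "antipode = lin_ext (\<lambda>(x, as). smult ((-1) ^ length as) (bvec (inv (tgt x as), reversal x as)))"

lemma antipode_bvec:
  "antipode (bvec (x, as)) = smult ((-1) ^ length as) (bvec (inv (tgt x as), reversal x as))"
  by (simp add: antipode_def)

lemma klin_antipode: "klin antipode"
  unfolding antipode_def by (rule klin_lin_ext)

lemma reversal_eq_Nil [simp]: "reversal x as = [] \<longleftrightarrow> as = []"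
  by (cases as) simp_all

lemma reversal_snoc:
  "reversal x (as @ [a]) = L (inv (head Q a)) (R a (inv (tgt x as))) # reversal x as"
  by (induction as arbitrary: x) simp_all

text \<open>An arrow from \<open>x\<close> to \<open>y\<close>, translated by \<open>inv y\<close>
  on the left and by \<open>inv x\<close> on the right, leads from \<open>inv y\<close> to
  \<open>inv x\<close>; in reversed order these arrows compose.\<close>

lemma reversal_path:
  "(x, as) \<in> paths Q \<Longrightarrow> (inv (tgt x as), reversal x as) \<in> paths Q \<and> tgt (inv (tgt x as)) (reversal x as) = inv x"
  by (induction as arbitrary: x) (auto simp: path_source path_target_in_verts vert_assoc)

lemma path_nth:
  assumes "(x, as) \<in> paths Q" "i < length as"
  shows "as ! i \<in> arcs Q" "tail Q (as ! i) = tgt x (take i as)" "head Q (as ! i) = tgt x (take (Suc i) as)"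
    "(x, take i as) \<in> paths Q" "(tgt x (take i as), drop i as) \<in> paths Q"
    "(x, take (Suc i) as) \<in> paths Q" "(tgt x (take (Suc i) as), drop (Suc i) as) \<in> paths Q"
proof -
  have "as = take i as @ as ! i # drop (Suc i) as" using assms(2) by (rule id_take_nth_drop)
  then have "(x, take i as @ as ! i # drop (Suc i) as) \<in> paths Q" using assms(1) by simp
  then have P: "(x, take i as) \<in> paths Q" "as ! i \<in> arcs Q" "tail Q (as ! i) = tgt x (take i as)"
    "(head Q (as ! i), drop (Suc i) as) \<in> paths Q"
    unfolding path_append path_Cons by simp_all
  moreover have "take (Suc i) as = take i as @ [as ! i]" using assms(2) by (rule take_Suc_conv_app_nth)
  moreover have "drop i as = as ! i # drop (Suc i) as" using assms(2) by (simp add: Cons_nth_drop_Suc)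
  ultimately show "as ! i \<in> arcs Q" "tail Q (as ! i) = tgt x (take i as)" "head Q (as ! i) = tgt x (take (Suc i) as)"
    "(x, take i as) \<in> paths Q" "(tgt x (take i as), drop i as) \<in> paths Q"
    "(x, take (Suc i) as) \<in> paths Q" "(tgt x (take (Suc i) as), drop (Suc i) as) \<in> paths Q"
    by simp_all
qed

text \<open>An arbitrary \<open>F\<close> separates the cancellation of arrow lists from the vertex
  at which the product paths start.\<close>

lemma antipode_cancel_left:
  fixes F :: "'a list \<Rightarrow> ('b \<Rightarrow>\<^sub>0 'k::field)"
  assumes P: "(x, as) \<in> paths Q" and ne: "as \<noteq> []"
  shows "splits x as (\<lambda>t d k. smult ((-1) ^ length d) (shuffles (inv (tgt t d)) (reversal t d) x k F)) = 0"
proof -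
  let ?n = "length as" and ?g = "inv (tgt x as)" and ?X = "\<lambda>i. tgt x (take i as)"
  define c where "c i = shuffles ?g (reversal (?X (Suc i)) (drop (Suc i) as)) x (take i as)
      (\<lambda>w. F (w @ [L (inv (?X (Suc i))) (as ! i)]))" for i
  have g: "tgt (?X i) (drop i as) = tgt x as" for i
    by (metis append_take_drop_id tgt_append)
  \<comment> \<open>The last step of a lattice path in the \<open>i\<close>-th product is \<open>x\<^sub>i\<^sub>+\<^sub>1\<^sup>-\<^sup>1 a\<^sub>i\<close> or \<open>x\<^sub>i\<^sup>-\<^sup>1 a\<^sub>i\<^sub>-\<^sub>1\<close>, so
     neighbouring terms cancel.\<close>
  have summand: "shuffles ?g (reversal (?X i) (drop i as)) x (take i as) F =
     (if i < ?n then c i else 0) + (if i > 0 then c (i - 1) else 0)" if "i \<le> ?n" for i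
  proof -
    have A: "shuffles ?g (butlast (reversal (?X i) (drop i as))) x (take i as)
        (\<lambda>w. F (w @ [R (last (reversal (?X i) (drop i as))) (tgt x (take i as))])) = c i"
      if "i < ?n"
    proof -
      note p = path_nth[OF P that]
      have "drop i as = as ! i # drop (Suc i) as" using that by (simp add: Cons_nth_drop_Suc)
      \<comment> \<open>Inside \<open>reversal\<close> the arrow is translated on the right by the
        inverse of \<open>?X i\<close>; the step is taken at the vertex \<open>?X i\<close>, which
        undoes this.\<close>
      moreover have "R (L (inv (?X (Suc i))) (R (as ! i) (inv (?X i)))) (?X i) = L (inv (?X (Suc i))) (as ! i)"
        using p by (simp add: path_target_in_verts flip: L_R R_mult)
      ultimately show ?thesis by (simp add: c_def p)
    qed
    have B: "shuffles ?g (reversal (?X i) (drop i as)) x (butlast (take i as))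
        (\<lambda>w. F (w @ [L (tgt ?g (reversal (?X i) (drop i as))) (last (take i as))])) = c (i - 1)"
      if "i > 0"
    proof -
      obtain j where j: "i = Suc j" "j < ?n" using \<open>i > 0\<close> \<open>i \<le> ?n\<close> by (cases i) auto
      note p = path_nth[OF P j(2)]
      have "take i as = take j as @ [as ! j]" unfolding j(1) using j(2) by (rule take_Suc_conv_app_nth)
      moreover have "tgt ?g (reversal (?X (Suc j)) (drop (Suc j) as)) = inv (?X (Suc j))"
        using reversal_path[OF p(7)] unfolding g by simp
      ultimately show ?thesis by (simp add: c_def j(1))
    qed
    show ?thesis
      using that A B ne by (subst shuffles_snoc) (auto simp: not_less)
  qed
  have "splits x as (\<lambda>t d k. smult ((-1) ^ length d) (shuffles (inv (tgt t d)) (reversal t d) x k F)) =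
      (\<Sum>i\<le>?n. smult ((-1) ^ ?n) (smult ((-1) ^ i) ((if i < ?n then c i else 0) + (if i > 0 then c (i - 1) else 0))))"
    unfolding splits_eq_sum g
  proof (rule sum.cong[OF refl])
    fix i assume "i \<in> {..?n}"
    then have i: "i \<le> ?n" by simp
    \<comment> \<open>The sign counts the \<open>?n - i\<close> arrows of the reversed factor; the
      constant \<open>(-1) ^ ?n\<close> is taken out of the sum.\<close>
    have "(-1::'k) ^ (?n - i) = (-1) ^ ?n * (-1) ^ i"
      using i by (metis (no_types) le_add_diff_inverse2 left_minus_one_mult_self mult.commute power_add)
    then show "smult ((-1) ^ length (drop i as)) (shuffles ?g (reversal (?X i) (drop i as)) x (take i as) F) =
      smult ((-1) ^ ?n) (smult ((-1) ^ i) ((if i < ?n then c i else 0) + (if i > 0 then c (i - 1) else 0)))"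
      using summand[OF i] by simp
  qed
  also have "\<dots> = 0"
    unfolding fs.scale_sum_right[symmetric] using alternating_telescope[of ?n c] ne by simp
  finally show ?thesis .
qed

text \<open>The recursion as one equation in \<open>hd\<close> and \<open>tl\<close>, for sides such
  as \<open>drop i as\<close> that are not given by a constructor.\<close>

lemma shuffles_Cons:
  "shuffles x as y bs F =
    (if as = [] \<and> bs = [] then F []
     else (if as \<noteq> [] then shuffles (head Q (hd as)) (tl as) y bs (\<lambda>w. F (R (hd as) y # w)) else 0) +
          (if bs \<noteq> [] then shuffles x as (head Q (hd bs)) (tl bs) (\<lambda>w. F (L x (hd bs) # w)) else 0))"
  by (cases as; cases bs) auto

text \<open>Mirror image of \<open>antipode_cancel_left\<close>: the reversed path is now the second
  factor, and neighbouring cuts share lattice paths with the same first step.\<close>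

lemma antipode_cancel_right:
  fixes F :: "'a list \<Rightarrow> ('b \<Rightarrow>\<^sub>0 'k::field)"
  assumes P: "(x, as) \<in> paths Q" and ne: "as \<noteq> []"
  shows "splits x as (\<lambda>t d k. smult ((-1) ^ length k) (shuffles t d (inv (tgt x k)) (reversal x k) F)) = 0"
proof -
  let ?n = "length as" and ?X = "\<lambda>i. tgt x (take i as)"
  \<comment> \<open>The first arrow singled out here comes from the remaining path at cut
    \<open>i\<close>, and from the reversed path at cut \<open>i + 1\<close>.\<close>
  define c where "c i = shuffles (?X (Suc i)) (drop (Suc i) as) (inv (?X i)) (reversal x (take i as))
      (\<lambda>w. F (R (as ! i) (inv (?X i)) # w))" for i
  have summand: "shuffles (?X i) (drop i as) (inv (?X i)) (reversal x (take i as)) F =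
     (if i < ?n then c i else 0) + (if i > 0 then c (i - 1) else 0)" if "i \<le> ?n" for i
  proof -
    have A: "shuffles (head Q (hd (drop i as))) (tl (drop i as)) (inv (?X i)) (reversal x (take i as))
        (\<lambda>w. F (R (hd (drop i as)) (inv (?X i)) # w)) = c i"
      if "i < ?n"
    proof -
      have "drop i as = as ! i # drop (Suc i) as" using that by (simp add: Cons_nth_drop_Suc)
      then show ?thesis by (simp add: c_def path_nth[OF P that])
    qed
    have B: "shuffles (?X i) (drop i as) (head Q (hd (reversal x (take i as)))) (tl (reversal x (take i as)))
        (\<lambda>w. F (L (?X i) (hd (reversal x (take i as))) # w)) = c (i - 1)"
      if "i > 0"
    proof -
      obtain j where j: "i = Suc j" "j < ?n" using \<open>i > 0\<close> \<open>i \<le> ?n\<close> by (cases i) auto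
      note p = path_nth[OF P j(2)]
      have X: "?X j \<in> verts Q" "?X (Suc j) \<in> verts Q" using p by (auto dest: path_source)
      have "take i as = take j as @ [as ! j]" unfolding j(1) using j(2) by (rule take_Suc_conv_app_nth)
      then have "reversal x (take i as) = L (inv (?X i)) (R (as ! j) (inv (?X j))) # reversal x (take j as)"
        using p by (simp add: reversal_snoc j(1))
      moreover have "L (?X i) (L (inv (?X i)) (R (as ! j) (inv (?X j)))) = R (as ! j) (inv (?X j))"
        using p X by (simp add: j(1) flip: L_mult)
      moreover have "inv (?X i) \<otimes> (?X i \<otimes> inv (?X j)) = inv (?X j)"
        using X by (simp add: j(1) flip: vert_assoc)
      ultimately show ?thesis using p X by (simp add: c_def j(1))
    qed
    show ?thesis
      using that A B ne by (subst shuffles_Cons) (auto simp: not_less)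
  qed
  have "splits x as (\<lambda>t d k. smult ((-1) ^ length k) (shuffles t d (inv (tgt x k)) (reversal x k) F)) =
      (\<Sum>i\<le>?n. smult ((-1) ^ i) ((if i < ?n then c i else 0) + (if i > 0 then c (i - 1) else 0)))"
    unfolding splits_eq_sum by (rule sum.cong) (simp_all add: summand min_absorb2)
  also have "\<dots> = 0"
    using ne by (intro alternating_telescope) simp
  finally show ?thesis .
qed

text \<open>Every axiom is reduced to basis paths, where it follows from the identities for
  \<open>splits\<close> and \<open>shuffles\<close>.\<close>

lemma graded_hopf_structure_shuffle_mul:
  "graded_hopf_structure Q (shuffle_mul :: _ \<Rightarrow> _ \<Rightarrow> (('v, 'a) path \<Rightarrow>\<^sub>0 'k::field)) (bvec (\<one>, [])) antipode"
proof -
  interpret k_coalgebra "paths Q" "path_comult Q" "path_counit :: (('v, 'a) path \<Rightarrow>\<^sub>0 'k) \<Rightarrow> 'k"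
    by (rule path_coalgebra)
  let ?mul = "shuffle_mul :: _ \<Rightarrow> _ \<Rightarrow> (('v, 'a) path \<Rightarrow>\<^sub>0 'k)"
  let ?u = "bvec (\<one>, []) :: ('v, 'a) path \<Rightarrow>\<^sub>0 'k"
  have comult_mul: "path_comult Q (?mul X Y) = tensor_mul ?mul (path_comult Q X) (path_comult Q Y)"
    if "X \<in> free_space (paths Q)" "Y \<in> free_space (paths Q)" for X Y
  proof (rule klin_eqI[OF _ _ that(1)])
    show "klin (\<lambda>X. path_comult Q (?mul X Y))"
      by (intro klin_compose[OF klin_path_comult] klin_shuffle_mul_left)
    show "klin (\<lambda>X. tensor_mul ?mul (path_comult Q X) (path_comult Q Y))"
      by (intro klin_compose[OF klin_tensor_mul_left] klin_path_comult)
    fix p assume p: "p \<in> paths Q"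
    show "path_comult Q (?mul (bvec p) Y) = tensor_mul ?mul (path_comult Q (bvec p)) (path_comult Q Y)"
    proof (rule klin_eqI[OF _ _ that(2)])
      show "klin (\<lambda>Y. path_comult Q (?mul (bvec p) Y))"
        by (intro klin_compose[OF klin_path_comult] klin_shuffle_mul_right)
      show "klin (\<lambda>Y. tensor_mul ?mul (path_comult Q (bvec p)) (path_comult Q Y))"
        by (intro klin_compose[OF klin_tensor_mul_right] klin_path_comult)
      fix q assume q: "q \<in> paths Q"
      obtain x as y bs where eq: "p = (x, as)" "q = (y, bs)" by (cases p; cases q) auto
      \<comment> \<open>Pushing the linear maps inside \<open>splits\<close> and
        \<open>shuffles\<close> until they act on basis vectors leaves exactly
        \<open>shuffles_splits\<close>.\<close>
      show "path_comult Q (?mul (bvec p) (bvec q)) = tensor_mul ?mul (path_comult Q (bvec p)) (path_comult Q (bvec q))"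
        using p q
        unfolding eq path_comult_bvec klin_splits[OF klin_tensor_mul_left]
        unfolding klin_splits[OF klin_tensor_mul_right] tensor_mul_bvec shuffle_mul_bvec klin_shuffles[OF klin_tensor_left]
        unfolding klin_shuffles[OF klin_tensor_right] tensor_bvec klin_shuffles[OF klin_path_comult] path_comult_bvec
        by (rule shuffles_splits)
    qed
  qed
  have assoc: "?mul (?mul X Y) Z = ?mul X (?mul Y Z)"
    if "X \<in> free_space (paths Q)" "Y \<in> free_space (paths Q)" "Z \<in> free_space (paths Q)" for X Y Z
  proof (rule klin_eqI[OF _ _ that(1)])
    show "klin (\<lambda>X. ?mul (?mul X Y) Z)"
      by (intro klin_compose[OF klin_shuffle_mul_left] klin_shuffle_mul_left)
    show "klin (\<lambda>X. ?mul X (?mul Y Z))" by (rule klin_shuffle_mul_left)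
    fix p assume p: "p \<in> paths Q"
    show "?mul (?mul (bvec p) Y) Z = ?mul (bvec p) (?mul Y Z)"
    proof (rule klin_eqI[OF _ _ that(2)])
      show "klin (\<lambda>Y. ?mul (?mul (bvec p) Y) Z)"
        by (intro klin_compose[OF klin_shuffle_mul_left] klin_shuffle_mul_right)
      show "klin (\<lambda>Y. ?mul (bvec p) (?mul Y Z))"
        by (intro klin_compose[OF klin_shuffle_mul_right] klin_shuffle_mul_left)
      fix q assume q: "q \<in> paths Q"
      show "?mul (?mul (bvec p) (bvec q)) Z = ?mul (bvec p) (?mul (bvec q) Z)"
      proof (rule klin_eqI[OF _ _ that(3)])
        show "klin (\<lambda>Z. ?mul (?mul (bvec p) (bvec q)) Z)" by (rule klin_shuffle_mul_right)
        show "klin (\<lambda>Z. ?mul (bvec p) (?mul (bvec q) Z))"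
          by (intro klin_compose[OF klin_shuffle_mul_right] klin_shuffle_mul_right)
        fix r assume r: "r \<in> paths Q"
        obtain x as y bs z cs where eq: "p = (x, as)" "q = (y, bs)" "r = (z, cs)"
          by (cases p; cases q; cases r) auto
        show "?mul (?mul (bvec p) (bvec q)) (bvec r) = ?mul (bvec p) (?mul (bvec q) (bvec r))"
          using p q r
            shuffles_assoc[of x as y bs z cs "\<lambda>w. bvec (x \<otimes> (y \<otimes> z), w) :: _ \<Rightarrow>\<^sub>0 'k"]
          by (simp add: eq shuffle_mul_bvec klin_shuffles[OF klin_shuffle_mul_left]
              klin_shuffles[OF klin_shuffle_mul_right] vert_assoc path_source)
      qed
    qed
  qed
  have counit_mul: "path_counit (?mul X Y) = path_counit X * path_counit Y"
    if "X \<in> free_space (paths Q)" "Y \<in> free_space (paths Q)" for X Y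
  proof -
    \<comment> \<open>The scalar equation is multiplied by \<open>?u\<close> to fit
      \<open>klin_eqI\<close>; the coefficient at \<open>(\<one>, [])\<close> recovers it
      afterwards.\<close>
    have "smult (path_counit (?mul X Y)) ?u = smult (path_counit X) (smult (path_counit Y) ?u)"
    proof (rule klin_eqI[OF _ _ that(1)])
      show "klin (\<lambda>X. smult (path_counit (?mul X Y)) ?u)"
        by (intro klin_compose[OF klin_path_counit] klin_shuffle_mul_left)
      show "klin (\<lambda>X. smult (path_counit X) (smult (path_counit Y) ?u))" by (rule klin_path_counit)
      fix p assume p: "p \<in> paths Q"
      show "smult (path_counit (?mul (bvec p) Y)) ?u = smult (path_counit (bvec p)) (smult (path_counit Y) ?u)"
      proof (rule klin_eqI[OF _ _ that(2)])
        show "klin (\<lambda>Y. smult (path_counit (?mul (bvec p) Y)) ?u)"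
          by (intro klin_compose[OF klin_path_counit] klin_shuffle_mul_right)
        show "klin (\<lambda>Y. smult (path_counit (bvec p)) (smult (path_counit Y) ?u))"
          by (intro klin_compose[OF fs.linear_scale_self] klin_path_counit)
        fix q assume q: "q \<in> paths Q"
        obtain x as y bs where eq: "p = (x, as)" "q = (y, bs)" by (cases p; cases q) auto
        show "smult (path_counit (?mul (bvec p) (bvec q))) ?u =
          smult (path_counit (bvec p)) (smult (path_counit (bvec q)) ?u)"
          \<comment> \<open>Unless both paths are vertices, every lattice path has positive length
            and hence counit 0.\<close>
          by (cases as; cases bs) (simp_all add: eq shuffle_mul_bvec klin_add[OF klin_path_counit]
              klin_shuffles[OF klin_path_counit])
      qed
    qed
    then have "Poly_Mapping.lookup (smult (path_counit (?mul X Y)) ?u) (\<one>, []) =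
        Poly_Mapping.lookup (smult (path_counit X) (smult (path_counit Y) ?u)) (\<one>, [])"
      by simp
    then show ?thesis by (simp add: lookup_bvec)
  qed
  have bialgebra: "k_bialgebra (paths Q) (path_comult Q) path_counit ?mul ?u"
  proof (unfold_locales; (rule assoc comult_mul counit_mul; assumption)?)
    fix Y :: "('v, 'a) path \<Rightarrow>\<^sub>0 'k" assume Y: "Y \<in> free_space (paths Q)"
    show "linear_map_on (paths Q) (paths Q) (\<lambda>X. ?mul X Y)"
      by (rule linear_map_on_klin[OF klin_shuffle_mul_left]) (use Y in \<open>auto intro: shuffle_mul_closed\<close>)
    show "linear_map_on (paths Q) (paths Q) (\<lambda>X. ?mul Y X)"
      by (rule linear_map_on_klin[OF klin_shuffle_mul_right]) (use Y in \<open>auto intro: shuffle_mul_closed\<close>)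
    show "?mul ?u Y = Y"
      by (rule klin_eqI[OF klin_shuffle_mul_right klin_ident Y])
        (auto simp: shuffle_mul_bvec shuffles_one_left path_source)
    show "?mul Y ?u = Y"
      by (rule klin_eqI[OF klin_shuffle_mul_left klin_ident Y])
        (auto simp: shuffle_mul_bvec shuffles_one_right path_source)
  qed (simp_all add: path_comult_bvec)
  interpret k_bialgebra "paths Q" "path_comult Q" path_counit ?mul ?u by (rule bialgebra)
  show ?thesis
  proof
    fix X Y n m
    show "X \<in> free_space (paths_of_length Q n) \<Longrightarrow> Y \<in> free_space (paths_of_length Q m) \<Longrightarrow>
        ?mul X Y \<in> free_space (paths_of_length Q (n + m))"
      by (rule shuffle_mul_graded)
    show "?u \<in> free_space (paths_of_length Q 0)" by (simp add: paths_of_length_def)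
    show "linear_map_on (paths Q) (paths Q) (antipode :: _ \<Rightarrow> (('v, 'a) path \<Rightarrow>\<^sub>0 'k))"
      by (rule linear_map_on_klin[OF klin_antipode])
        (auto simp: antipode_bvec reversal_path intro!: free_space_smult)
  next
    fix X :: "('v, 'a) path \<Rightarrow>\<^sub>0 'k" assume X: "X \<in> free_space (paths Q)"
    show "lin_ext (\<lambda>(a, b). ?mul (antipode (bvec a)) (bvec b)) (path_comult Q X) = smult (path_counit X) ?u"
    proof (rule klin_eqI[OF klin_compose[OF klin_lin_ext klin_path_comult] klin_path_counit X])
      fix p assume p: "p \<in> paths Q"
      obtain x as where eq: "p = (x, as)" by (cases p)
      \<comment> \<open>The remaining piece \<open>d\<close> ends where the whole path ends, so all
        summands start at the same vertex and \<open>antipode_cancel_left\<close> applies.\<close>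
      have inv: "splits x as (\<lambda>t d k. smult ((-1) ^ length d) (shuffles (inv (tgt t d)) (reversal t d) x k
            (\<lambda>w. bvec (inv (tgt t d) \<otimes> x, w)))) =
          splits x as (\<lambda>t d k. smult ((-1) ^ length d) (shuffles (inv (tgt t d)) (reversal t d) x k
            (\<lambda>w. bvec (inv (tgt x as) \<otimes> x, w) :: _ \<Rightarrow>\<^sub>0 'k)))"
        unfolding splits_eq_sum
        by (rule sum.cong) (simp_all add: append_take_drop_id flip: tgt_append)
      show "lin_ext (\<lambda>(a, b). ?mul (antipode (bvec a)) (bvec b)) (path_comult Q (bvec p)) =
          smult (path_counit (bvec p)) ?u"
        using p antipode_cancel_left[of x as "\<lambda>w. bvec (inv (tgt x as) \<otimes> x, w)"]
        by (cases "as = []")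
           (simp_all add: eq path_comult_bvec klin_splits[OF klin_lin_ext] antipode_bvec
            klin_scale[OF klin_shuffle_mul_left] shuffle_mul_bvec inv)
    qed
    show "lin_ext (\<lambda>(a, b). ?mul (bvec a) (antipode (bvec b))) (path_comult Q X) = smult (path_counit X) ?u"
    proof (rule klin_eqI[OF klin_compose[OF klin_lin_ext klin_path_comult] klin_path_counit X])
      fix p assume p: "p \<in> paths Q"
      obtain x as where eq: "p = (x, as)" by (cases p)
      \<comment> \<open>Here \<open>t\<close> and \<open>tgt x k\<close> are the same cut vertex, so
        every summand starts at the unit.\<close>
      have inv: "splits x as (\<lambda>t d k. smult ((-1) ^ length k) (shuffles t d (inv (tgt x k)) (reversal x k)
            (\<lambda>w. bvec (t \<otimes> inv (tgt x k), w)))) =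
          splits x as (\<lambda>t d k. smult ((-1) ^ length k) (shuffles t d (inv (tgt x k)) (reversal x k)
            (\<lambda>w. bvec (\<one>, w) :: _ \<Rightarrow>\<^sub>0 'k)))"
        unfolding splits_eq_sum
      proof (rule sum.cong[OF refl])
        fix i
        have "(x, take i as @ drop i as) \<in> paths Q" using p eq by simp
        then have "tgt x (take i as) \<in> verts Q" unfolding path_append by (auto dest: path_source)
        then show "smult ((-1) ^ length (take i as)) (shuffles (tgt x (take i as)) (drop i as) (inv (tgt x (take i as)))
            (reversal x (take i as)) (\<lambda>w. bvec (tgt x (take i as) \<otimes> inv (tgt x (take i as)), w))) =
          smult ((-1) ^ length (take i as)) (shuffles (tgt x (take i as)) (drop i as) (inv (tgt x (take i as)))
            (reversal x (take i as)) (\<lambda>w. bvec (\<one>, w) :: _ \<Rightarrow>\<^sub>0 'k))"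
          by simp
      qed
      show "lin_ext (\<lambda>(a, b). ?mul (bvec a) (antipode (bvec b))) (path_comult Q (bvec p)) =
          smult (path_counit (bvec p)) ?u"
        using p antipode_cancel_right[of x as "\<lambda>w. bvec (\<one>, w)"]
        by (cases "as = []")
           (simp_all add: eq path_comult_bvec klin_splits[OF klin_lin_ext] antipode_bvec
            klin_scale[OF klin_shuffle_mul_right] shuffle_mul_bvec inv)
    qed
  qed
qed

end

section \<open>Hopf quivers and translation-invariant quivers\<close>

lemma conj_class_conjugate:
  assumes "group G" "g \<in> carrier G" "c \<in> carrier G"
  shows "conj_class G (g \<otimes>\<^bsub>G\<^esub> c \<otimes>\<^bsub>G\<^esub> inv\<^bsub>G\<^esub> g) = conj_class G c"
proof -
  interpret group G by fact
  \<comment> \<open>Proved for arbitrary \<open>h\<close> and \<open>d\<close>, since the reverse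
    inclusion is the same fact for conjugation by the inverse of \<open>g\<close>.\<close>
  have sub: "conj_class G (h \<otimes>\<^bsub>G\<^esub> d \<otimes>\<^bsub>G\<^esub> inv\<^bsub>G\<^esub> h) \<subseteq> conj_class G d"
    if "h \<in> carrier G" "d \<in> carrier G" for h d
  proof
    fix x assume "x \<in> conj_class G (h \<otimes>\<^bsub>G\<^esub> d \<otimes>\<^bsub>G\<^esub> inv\<^bsub>G\<^esub> h)"
    then obtain k where k: "k \<in> carrier G" "x = k \<otimes>\<^bsub>G\<^esub> (h \<otimes>\<^bsub>G\<^esub> d \<otimes>\<^bsub>G\<^esub> inv\<^bsub>G\<^esub> h) \<otimes>\<^bsub>G\<^esub> inv\<^bsub>G\<^esub> k"
      by (auto simp: conj_class_def)
    then have "x = (k \<otimes>\<^bsub>G\<^esub> h) \<otimes>\<^bsub>G\<^esub> d \<otimes>\<^bsub>G\<^esub> inv\<^bsub>G\<^esub> (k \<otimes>\<^bsub>G\<^esub> h)"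
      using that by (simp add: m_assoc inv_mult_group)
    then show "x \<in> conj_class G d" using k that by (auto simp: conj_class_def)
  qed
  have "inv\<^bsub>G\<^esub> g \<otimes>\<^bsub>G\<^esub> (g \<otimes>\<^bsub>G\<^esub> c \<otimes>\<^bsub>G\<^esub> inv\<^bsub>G\<^esub> g) \<otimes>\<^bsub>G\<^esub> inv\<^bsub>G\<^esub> (inv\<^bsub>G\<^esub> g) = c"
    using assms by (simp add: m_assoc inv_solve_left')
  then show ?thesis
    using sub[of g c] sub[of "inv\<^bsub>G\<^esub> g" "g \<otimes>\<^bsub>G\<^esub> c \<otimes>\<^bsub>G\<^esub> inv\<^bsub>G\<^esub> g"] assms by auto
qed

text \<open>The group and the two actions are carried over to \<open>Q\<close> itself, so that the
  Hopf structure is built directly on \<open>Q\<close> and no Hopf structure has to be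
  transported.\<close>

lemma biaction_quiver_of_iso:
  assumes "wf_digraph Q" "group G" "digraph_iso Q (hopf_quiver G r)"
  shows "\<exists>H L R. biaction_quiver Q H L R"
proof -
  interpret Q: wf_digraph Q by fact
  interpret G: group G by fact
  obtain f where f: "Q.digraph_isomorphism f" "hopf_quiver G r = app_iso f Q"
    using assms(3) by (auto simp: digraph_iso_def)
  define \<phi> where "\<phi> = iso_verts f"
  define \<psi> where "\<psi> = iso_arcs f"
  let ?A = "arcs (hopf_quiver G r)"
  have bij: "bij_betw \<phi> (verts Q) (carrier G)" and bij': "bij_betw \<psi> (arcs Q) ?A"
  proof -
    have "verts (hopf_quiver G r) = \<phi> ` verts Q" "?A = \<psi> ` arcs Q"
      unfolding f(2) by (simp_all add: \<phi>_def \<psi>_def)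
    then show "bij_betw \<phi> (verts Q) (carrier G)" "bij_betw \<psi> (arcs Q) ?A"
      using f(1) by (simp_all add: bij_betw_def Q.digraph_isomorphism_def \<phi>_def \<psi>_def hopf_quiver_def)
  qed
  have th: "\<phi> (tail Q a) = tail (hopf_quiver G r) (\<psi> a)" "\<phi> (head Q a) = head (hopf_quiver G r) (\<psi> a)"
    if "a \<in> arcs Q" for a
    using f that by (simp_all add: Q.digraph_isomorphism_def \<phi>_def \<psi>_def)
  define \<phi>' where "\<phi>' = inv_into (verts Q) \<phi>"
  define \<psi>' where "\<psi>' = inv_into (arcs Q) \<psi>"
  have [simp]: "\<phi> x \<in> carrier G" if "x \<in> verts Q" for x using bij that by (auto simp: bij_betw_def)
  have [simp]: "\<phi>' x \<in> verts Q" "\<phi> (\<phi>' x) = x" if "x \<in> carrier G" for x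
    using bij that by (auto simp: \<phi>'_def bij_betw_def inv_into_into f_inv_into_f)
  have [simp]: "\<phi>' (\<phi> x) = x" if "x \<in> verts Q" for x
    using bij that by (auto simp: \<phi>'_def bij_betw_def)
  have [simp]: "\<psi>' a \<in> arcs Q" "\<psi> (\<psi>' a) = a" if "a \<in> ?A" for a
    using bij' that by (auto simp: \<psi>'_def bij_betw_def inv_into_into f_inv_into_f)
  have [simp]: "\<psi>' (\<psi> a) = a" if "a \<in> arcs Q" for a
    using bij' that by (auto simp: \<psi>'_def bij_betw_def)
  have th': "tail Q (\<psi>' a) = \<phi>' (tail (hopf_quiver G r) a)" "head Q (\<psi>' a) = \<phi>' (head (hopf_quiver G r) a)"
    if "a \<in> ?A" for a
    using th[of "\<psi>' a"] that by (metis Q.tail_in_verts Q.head_in_verts \<open>\<And>x. x \<in> verts Q \<Longrightarrow> \<phi>' (\<phi> x) = x\<close>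
      \<open>\<And>a. a \<in> ?A \<Longrightarrow> \<psi>' a \<in> arcs Q\<close> \<open>\<And>a. a \<in> ?A \<Longrightarrow> \<psi> (\<psi>' a) = a\<close>)+
  define H where "H = \<lparr>carrier = verts Q, monoid.mult = \<lambda>x y. \<phi>' (\<phi> x \<otimes>\<^bsub>G\<^esub> \<phi> y), one = \<phi>' \<one>\<^bsub>G\<^esub>\<rparr>"
  \<comment> \<open>Conjugating \<open>c\<close> by \<open>g\<close> makes the new head
    \<open>g c x\<close>, as left translation requires; for \<open>R\<close> the head
    \<open>c x g\<close> comes out with \<open>c\<close> unchanged.\<close>
  define L where "L g a = \<psi>' (case \<psi> a of (x, c, i) \<Rightarrow> (\<phi> g \<otimes>\<^bsub>G\<^esub> x, \<phi> g \<otimes>\<^bsub>G\<^esub> c \<otimes>\<^bsub>G\<^esub> inv\<^bsub>G\<^esub> (\<phi> g), i))" for g a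
  define R where "R a g = \<psi>' (case \<psi> a of (x, c, i) \<Rightarrow> (x \<otimes>\<^bsub>G\<^esub> \<phi> g, c, i))" for g a
  have H [simp]: "carrier H = verts Q" "x \<otimes>\<^bsub>H\<^esub> y = \<phi>' (\<phi> x \<otimes>\<^bsub>G\<^esub> \<phi> y)" "\<one>\<^bsub>H\<^esub> = \<phi>' \<one>\<^bsub>G\<^esub>" for x y
    by (simp_all add: H_def)
  have [simp]: "inv\<^bsub>G\<^esub> x \<otimes>\<^bsub>G\<^esub> (x \<otimes>\<^bsub>G\<^esub> y) = y" if "x \<in> carrier G" "y \<in> carrier G" for x y
    using that by (simp flip: G.m_assoc)
  have "group H"
  proof (rule groupI)
    fix x assume x: "x \<in> carrier H"
    show "\<exists>y\<in>carrier H. y \<otimes>\<^bsub>H\<^esub> x = \<one>\<^bsub>H\<^esub>"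
      using x by (intro bexI[of _ "\<phi>' (inv\<^bsub>G\<^esub> \<phi> x)"]) simp_all
  qed (simp_all add: G.m_assoc)
  moreover have "biaction_quiver_axioms Q H L R"
  proof
    have mem: "\<exists>x c i. \<psi> a = (x, c, i) \<and> x \<in> carrier G \<and> c \<in> carrier G \<and> (x, c, i) \<in> ?A"
      if "a \<in> arcs Q" for a
    proof -
      have "\<psi> a \<in> ?A" using bij' that by (auto simp: bij_betw_def)
      then show ?thesis by (auto simp: hopf_quiver_def)
    qed
    \<comment> \<open>Conjugation preserves the class of \<open>c\<close> and with it the bound on
      the index \<open>i\<close>.\<close>
    have A: "(\<phi> g \<otimes>\<^bsub>G\<^esub> x, \<phi> g \<otimes>\<^bsub>G\<^esub> c \<otimes>\<^bsub>G\<^esub> inv\<^bsub>G\<^esub> (\<phi> g), i) \<in> ?A" "(x \<otimes>\<^bsub>G\<^esub> \<phi> g, c, i) \<in> ?A"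
      if "(x, c, i) \<in> ?A" "g \<in> verts Q" for x c i g
      using that by (auto simp: hopf_quiver_def conj_class_conjugate[OF assms(2)])
    have tl: "tail (hopf_quiver G r) (x, c, i) = x" "head (hopf_quiver G r) (x, c, i) = c \<otimes>\<^bsub>G\<^esub> x" for x c i
      by (simp_all add: hopf_quiver_def)
    have one: "L \<one>\<^bsub>H\<^esub> a = a" "R a \<one>\<^bsub>H\<^esub> = a" if a: "a \<in> arcs Q" for a
    proof -
      obtain x c i where "\<psi> a = (x, c, i)" "x \<in> carrier G" "c \<in> carrier G" using mem[OF a] by auto
      moreover from this have "\<psi>' (x, c, i) = a" using a by (metis \<open>\<And>a. a \<in> arcs Q \<Longrightarrow> \<psi>' (\<psi> a) = a\<close>)
      ultimately show "L \<one>\<^bsub>H\<^esub> a = a" "R a \<one>\<^bsub>H\<^esub> = a" by (simp_all add: L_def R_def)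
    qed
    show "a \<in> arcs Q \<Longrightarrow> L \<one>\<^bsub>H\<^esub> a = a" "a \<in> arcs Q \<Longrightarrow> R a \<one>\<^bsub>H\<^esub> = a" for a
      using one[of a] by blast+
    fix g h a assume g: "g \<in> verts Q" and h: "h \<in> verts Q" and a: "a \<in> arcs Q"
    obtain x c i where e: "\<psi> a = (x, c, i)" "x \<in> carrier G" "c \<in> carrier G" "(x, c, i) \<in> ?A"
      using mem[OF a] by auto
    have a': "a = \<psi>' (x, c, i)" using a e(1) by (metis \<open>\<And>a. a \<in> arcs Q \<Longrightarrow> \<psi>' (\<psi> a) = a\<close>)
    note A' = A[OF e(4)] A[OF A(1)[OF e(4)]] A[OF A(2)[OF e(4)]]
    show "L g a \<in> arcs Q" using g e A' by (simp add: L_def)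
    show "R a g \<in> arcs Q" using g e A' by (simp add: R_def)
    show "tail Q (L g a) = g \<otimes>\<^bsub>H\<^esub> tail Q a" "tail Q (R a g) = tail Q a \<otimes>\<^bsub>H\<^esub> g"
      using g e A' by (simp_all add: L_def R_def a' th' tl)
    show "head Q (L g a) = g \<otimes>\<^bsub>H\<^esub> head Q a" "head Q (R a g) = head Q a \<otimes>\<^bsub>H\<^esub> g"
      using g e A' by (simp_all add: L_def R_def a' th' tl G.m_assoc)
    show "L (g \<otimes>\<^bsub>H\<^esub> h) a = L g (L h a)"
      using g h e A' by (simp add: L_def a' G.m_assoc G.inv_mult_group)
    show "R a (g \<otimes>\<^bsub>H\<^esub> h) = R (R a g) h"
      using g h e A' by (simp add: R_def a' G.m_assoc)
    show "L g (R a h) = R (L g a) h"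
      using g h e A' by (simp add: L_def R_def a' G.m_assoc)
  qed simp
  ultimately have "biaction_quiver Q H L R"
    using assms(1) by (intro biaction_quiver.intro)
  then show ?thesis by blast
qed

section \<open>Translation-invariant arrow counts\<close>

definition arrows :: "('v, 'a) pre_digraph \<Rightarrow> 'v \<Rightarrow> 'v \<Rightarrow> 'a set" where
  "arrows Q x y = {a \<in> arcs Q. tail Q a = x \<and> head Q a = y}"

text \<open>By right invariance the arrows from \<open>x\<close> to \<open>y\<close> are as many as
  those from \<open>\<one>\<close> to \<open>y \<otimes> inv x\<close>, and the number of arrows
  from \<open>\<one>\<close> to \<open>c\<close> is constant on conjugacy classes; its values are
  the coefficients.\<close>

lemma hopf_quiver_of_invariant_arrows:
  fixes H :: "'v monoid" (structure)
  assumes wf: "wf_digraph Q" and "group H" and carrier: "carrier H = verts Q"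
    and fin: "\<And>x y. x \<in> verts Q \<Longrightarrow> y \<in> verts Q \<Longrightarrow> finite (arrows Q x y)"
    and left: "\<And>g x y. g \<in> verts Q \<Longrightarrow> x \<in> verts Q \<Longrightarrow> y \<in> verts Q \<Longrightarrow>
        card (arrows Q (g \<otimes> x) (g \<otimes> y)) = card (arrows Q x y)"
    and right: "\<And>g x y. g \<in> verts Q \<Longrightarrow> x \<in> verts Q \<Longrightarrow> y \<in> verts Q \<Longrightarrow>
        card (arrows Q (x \<otimes> g) (y \<otimes> g)) = card (arrows Q x y)"
  shows "\<exists>r. ramification_data H r \<and> digraph_iso Q (hopf_quiver H r)"
proof -
  interpret Q: wf_digraph Q by fact
  interpret group H by fact
  note carrier [symmetric, simp]
  have [simp]: "tail Q a \<in> carrier H" "head Q a \<in> carrier H" if "a \<in> arcs Q" for a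
    using Q.tail_in_verts[OF that] Q.head_in_verts[OF that] by simp_all
  let ?n = "\<lambda>x y. card (arrows Q x y)"
  \<comment> \<open>Any representative of the class will do, as \<open>conj\<close> shows.\<close>
  define r where "r C = (if C \<in> conj_classes H then ?n \<one> (SOME c. c \<in> C) else 0)" for C
  \<comment> \<open>The pair \<open>\<one>\<close>, \<open>c\<close> is translated by
    \<open>g\<close> on the left and by its inverse on the right.\<close>
  have conj: "?n \<one> (g \<otimes> c \<otimes> inv g) = ?n \<one> c" if "g \<in> carrier H" "c \<in> carrier H" for g c
    using left[of g \<one> c] right[of "inv g" g "g \<otimes> c"] that by simp
  have r: "r (conj_class H c) = ?n \<one> c" if c: "c \<in> carrier H" for c
  proof -
    have "c = \<one> \<otimes> c \<otimes> inv \<one>" using c by simp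
    then have "c \<in> conj_class H c" unfolding conj_class_def by blast
    then have "(SOME d. d \<in> conj_class H c) \<in> conj_class H c" by (rule someI)
    then show ?thesis using c conj by (auto simp: r_def conj_class_def conj_classes_def)
  qed
  \<comment> \<open>An arbitrary numbering of the arrows from \<open>x\<close> to \<open>y\<close>;
    it supplies the index in the triple \<open>\<psi> a\<close>.\<close>
  define \<iota> where "\<iota> x y = (SOME h. bij_betw h (arrows Q x y) {0..<?n x y})" for x y
  have \<iota>: "bij_betw (\<iota> x y) (arrows Q x y) {0..<?n x y}" if "x \<in> verts Q" "y \<in> verts Q" for x y
    unfolding \<iota>_def by (rule someI_ex[OF ex_bij_betw_finite_nat[OF fin[OF that]]])
  define \<psi> where "\<psi> a = (tail Q a, head Q a \<otimes> inv (tail Q a), \<iota> (tail Q a) (head Q a) a)" for a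
  have n: "r (conj_class H (y \<otimes> inv x)) = ?n x y" if "x \<in> carrier H" "y \<in> carrier H" for x y
    using right[of "inv x" x y] that by (simp add: r)
  have "inj_on \<psi> (arcs Q)"
  proof (rule inj_onI)
    fix a b assume a: "a \<in> arcs Q" and b: "b \<in> arcs Q" and eq: "\<psi> a = \<psi> b"
    from a b eq have h: "tail Q a = tail Q b" "head Q a = head Q b" by (auto simp: \<psi>_def)
    with a b have "a \<in> arrows Q (tail Q a) (head Q a)" "b \<in> arrows Q (tail Q a) (head Q a)"
      by (auto simp: arrows_def)
    then show "a = b"
      using \<iota>[of "tail Q a" "head Q a"] eq h a b by (auto simp: \<psi>_def bij_betw_def dest: inj_onD)
  qed
  moreover have "\<psi> ` arcs Q = arcs (hopf_quiver H r)"
  proof (intro equalityI subsetI, elim imageE, hypsubst)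
    fix a assume a: "a \<in> arcs Q"
    then have "\<iota> (tail Q a) (head Q a) a \<in> {0..<?n (tail Q a) (head Q a)}"
      using \<iota>[of "tail Q a" "head Q a"] by (auto simp: arrows_def bij_betw_def)
    then show "\<psi> a \<in> arcs (hopf_quiver H r)"
      using a by (simp add: \<psi>_def hopf_quiver_def n)
  next
    fix t assume t: "t \<in> arcs (hopf_quiver H r)"
    obtain x c i where eq: "t = (x, c, i)" by (cases t)
    from t have x: "x \<in> carrier H" "c \<in> carrier H" and i: "i < ?n x (c \<otimes> x)"
      using n[of x "c \<otimes> x"] by (auto simp: eq hopf_quiver_def m_assoc)
    then have "i \<in> \<iota> x (c \<otimes> x) ` arrows Q x (c \<otimes> x)"
      using \<iota>[of x "c \<otimes> x"] by (simp add: bij_betw_def)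
    then obtain a where "a \<in> arrows Q x (c \<otimes> x)" "i = \<iota> x (c \<otimes> x) a" by auto
    then show "t \<in> \<psi> ` arcs Q"
      using x by (intro image_eqI[of _ _ a]) (auto simp: eq \<psi>_def arrows_def m_assoc)
  qed
  moreover define f where "f = \<lparr>iso_verts = id, iso_arcs = \<psi>,
      iso_head = head (hopf_quiver H r), iso_tail = tail (hopf_quiver H r)\<rparr>"
  ultimately have "Q.digraph_isomorphism f" "hopf_quiver H r = app_iso f Q"
    using wf by (auto simp: Q.digraph_isomorphism_def app_iso_def hopf_quiver_def \<psi>_def m_assoc
        intro!: pre_digraph.equality)
  then have "digraph_iso Q (hopf_quiver H r)" by (auto simp: digraph_iso_def)
  moreover have "ramification_data H r" by (simp add: ramification_data_def r_def)
  ultimately show ?thesis by blast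
qed

section \<open>The quiver of a graded Hopf structure\<close>

locale graded_hopf_quiver = wf_digraph Q + graded_hopf_structure Q mul u S
  for Q :: "('v, 'a) pre_digraph"
    and mul :: "(('v, 'a) path \<Rightarrow>\<^sub>0 'k::field) \<Rightarrow> (('v, 'a) path \<Rightarrow>\<^sub>0 'k) \<Rightarrow> (('v, 'a) path \<Rightarrow>\<^sub>0 'k)"
    and u :: "('v, 'a) path \<Rightarrow>\<^sub>0 'k"
    and S :: "(('v, 'a) path \<Rightarrow>\<^sub>0 'k) \<Rightarrow> (('v, 'a) path \<Rightarrow>\<^sub>0 'k)"
begin

abbreviation vert :: "'v \<Rightarrow> (('v, 'a) path \<Rightarrow>\<^sub>0 'k)" where
  "vert v \<equiv> bvec (v, [])"

lemma mul_lin_ext_left: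
  "x \<in> free_space (paths Q) \<Longrightarrow> y \<in> free_space (paths Q) \<Longrightarrow> mul x y = lin_ext (\<lambda>p. mul (bvec p) y) x"
  using linear_map_on_eq_lin_ext[OF mul_linear_left] .

lemma mul_lin_ext_right:
  "x \<in> free_space (paths Q) \<Longrightarrow> y \<in> free_space (paths Q) \<Longrightarrow> mul x y = lin_ext (\<lambda>p. mul x (bvec p)) y"
  using linear_map_on_eq_lin_ext[OF mul_linear_right] .

section \<open>Degree 0: the group of vertices\<close>

lemma length_0: "z \<in> free_space (paths_of_length Q 0) \<longleftrightarrow> Poly_Mapping.keys z \<subseteq> (\<lambda>v. (v, [])) ` verts Q"
proof -
  have "paths_of_length Q 0 = (\<lambda>v. (v, [])) ` verts Q" by (auto simp: paths_of_length_def)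
  then show ?thesis by (simp add: free_space_def)
qed

lemma lookup_path_comult:
  fixes z :: "('v, 'a) path \<Rightarrow>\<^sub>0 'k"
  shows "Poly_Mapping.lookup (path_comult Q z) t =
    (\<Sum>p\<in>Poly_Mapping.keys z. Poly_Mapping.lookup z p * Poly_Mapping.lookup (path_comult Q (bvec p) :: _ \<Rightarrow>\<^sub>0 'k) t)"
  by (subst klin_eq_lin_ext[OF klin_path_comult]) (rule lookup_lin_ext)

lemma lookup_comult_length_0:
  fixes z :: "('v, 'a) path \<Rightarrow>\<^sub>0 'k"
  assumes "z \<in> free_space (paths_of_length Q 0)"
  shows "Poly_Mapping.lookup (path_comult Q z) ((v, []), (w, [])) =
    (if v = w then Poly_Mapping.lookup z (v, []) else 0)"
proof -
  have "Poly_Mapping.lookup (path_comult Q z) ((v, []), (w, [])) =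
     (\<Sum>p\<in>Poly_Mapping.keys z. if p = (v, []) then (if v = w then Poly_Mapping.lookup z p else 0) else 0)"
  proof (subst lookup_path_comult, rule sum.cong[OF refl])
    fix p assume "p \<in> Poly_Mapping.keys z"
    then obtain x where "p = (x, [])" using assms by (auto simp: length_0)
    then show "Poly_Mapping.lookup z p * Poly_Mapping.lookup (path_comult Q (bvec p) :: _ \<Rightarrow>\<^sub>0 'k) ((v, []), (w, [])) =
      (if p = (v, []) then (if v = w then Poly_Mapping.lookup z p else 0) else 0)"
      by (auto simp: path_comult_bvec lookup_bvec)
  qed
  then show ?thesis by (simp add: in_keys_iff)
qed

text \<open>Comparing coefficients in \<Delta> z = z \<otimes> z, each coefficient is idempotent and
  those at distinct vertices multiply to 0. The counit excludes z = 0, so exactly one coefficient is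
  1.\<close>

lemma grouplike_length_0:
  assumes z: "z \<in> free_space (paths_of_length Q 0)" and "path_comult Q z = tensor z z" "path_counit z = 1"
  shows "\<exists>v\<in>verts Q. z = vert v"
proof -
  have eq: "Poly_Mapping.lookup z (v, []) * Poly_Mapping.lookup z (w, []) =
      (if v = w then Poly_Mapping.lookup z (v, []) else 0)" for v w
    using lookup_comult_length_0[OF z, of v w] assms(2) by simp
  have "z \<noteq> 0" using assms(3) by (auto simp: path_counit_def)
  then obtain p where p: "p \<in> Poly_Mapping.keys z" by (auto simp flip: keys_eq_empty)
  have keys: "\<exists>v\<in>verts Q. p = (v, [])" if "p \<in> Poly_Mapping.keys z" for p
    using subsetD[OF z[unfolded length_0] that] by (auto simp: image_iff)
  then obtain v where v: "v \<in> verts Q" "(v, []) \<in> Poly_Mapping.keys z"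
    using p by metis
  have one: "Poly_Mapping.lookup z (v, []) = 1"
    using eq[of v v] v(2) by (simp add: in_keys_iff)
  have "z = vert v"
  proof (rule poly_mapping_eqI)
    fix p :: "('v, 'a) path"
    show "Poly_Mapping.lookup z p = Poly_Mapping.lookup (vert v) p"
    proof (cases "p \<in> Poly_Mapping.keys z")
      case True
      then obtain w where w: "p = (w, [])" using keys by metis
      have "Poly_Mapping.lookup z (w, []) = (if v = w then 1 else 0)"
        using eq[of v w] unfolding one by simp
      then show ?thesis by (simp add: w lookup_bvec)
    next
      case False
      then have "p \<noteq> (v, [])" using v(2) by metis
      then show ?thesis using False by (simp add: lookup_bvec in_keys_iff)
    qed
  qed
  then show ?thesis using v(1) by (rule bexI)
qed

lemma vert_mul_vert:
  assumes "x \<in> verts Q" "y \<in> verts Q"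
  shows "\<exists>v\<in>verts Q. mul (vert x) (vert y) = vert v"
proof (rule grouplike_length_0)
  show "mul (vert x) (vert y) \<in> free_space (paths_of_length Q 0)"
    using mul_graded[of "vert x" 0 "vert y" 0] assms by (simp add: paths_of_length_def)
  show "path_comult Q (mul (vert x) (vert y)) = tensor (mul (vert x) (vert y)) (mul (vert x) (vert y))"
    using assms by (simp add: comult_mul path_comult_bvec)
  show "path_counit (mul (vert x) (vert y)) = 1"
    using assms by (simp add: counit_mul)
qed

definition vmul :: "'v \<Rightarrow> 'v \<Rightarrow> 'v" where
  "vmul x y = (SOME v. v \<in> verts Q \<and> mul (vert x) (vert y) = vert v)"

definition vone :: 'v where
  "vone = (SOME v. v \<in> verts Q \<and> u = vert v)"

lemma vmul: "x \<in> verts Q \<Longrightarrow> y \<in> verts Q \<Longrightarrow> vmul x y \<in> verts Q \<and> mul (vert x) (vert y) = vert (vmul x y)"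
  unfolding vmul_def by (rule someI_ex) (use vert_mul_vert in blast)

lemma vone: "vone \<in> verts Q \<and> u = vert vone"
  unfolding vone_def
  by (rule someI_ex) (use grouplike_length_0[OF unit_graded comult_unit counit_unit] in blast)

definition vgroup :: "'v monoid" where
  "vgroup = \<lparr>carrier = verts Q, monoid.mult = vmul, one = vone\<rparr>"

lemma vgroup_simps [simp]: "carrier vgroup = verts Q" "monoid.mult vgroup = vmul" "one vgroup = vone"
  by (simp_all add: vgroup_def)

text \<open>The antipode is not assumed to be graded, so \<open>S (vert v)\<close> may a priori
  involve longer paths. The inverse is found as a vertex in its support whose product with
  \<open>v\<close> contributes to the unit.\<close>

lemma vmul_left_inverse:
  assumes v: "v \<in> verts Q"
  shows "\<exists>w\<in>verts Q. vmul w v = vone"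
proof -
  let ?s = "S (vert v)"
  have s: "?s \<in> free_space (paths Q)" using antipode_linear v by (auto simp: linear_map_on_def)
  have "mul ?s (vert v) = vert vone"
    using antipode_left[of "vert v"] v vone by (simp add: path_comult_bvec)
  then have "Poly_Mapping.lookup (lin_ext (\<lambda>p. mul (bvec p) (vert v)) ?s) (vone, []) \<noteq> 0"
    using mul_lin_ext_left[OF s, of "vert v"] v by (simp add: lookup_bvec)
  then obtain p where p: "p \<in> Poly_Mapping.keys ?s" "Poly_Mapping.lookup (mul (bvec p) (vert v)) (vone, []) \<noteq> 0"
    unfolding lookup_lin_ext by (metis (no_types, lifting) mult_zero_right sum.neutral)
  then obtain w as where eq: "p = (w, as)" "(w, as) \<in> paths Q"
    using s by (cases p) (auto simp: free_space_def)
  have "mul (bvec p) (vert v) \<in> free_space (paths_of_length Q (length as + 0))"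
    using eq v by (intro mul_graded) (auto simp: paths_of_length_def)
  moreover have "(vone, []) \<in> Poly_Mapping.keys (mul (bvec p) (vert v))"
    using p by (simp add: in_keys_iff)
  \<comment> \<open>Multiplication by \<open>vert v\<close> preserves length, so a path contributing
    to the coefficient at \<open>(vone, [])\<close> has length 0.\<close>
  ultimately have "as = []" by (auto simp: free_space_def paths_of_length_def)
  then have "w \<in> verts Q" "vmul w v = vone"
    using p eq v vmul[of w v] by (auto simp: lookup_bvec split: if_splits)
  then show ?thesis by blast
qed

lemma group_vgroup: "group vgroup"
proof (rule groupI)
  fix x y z assume "x \<in> carrier vgroup" "y \<in> carrier vgroup" "z \<in> carrier vgroup"
  then have xyz: "x \<in> verts Q" "y \<in> verts Q" "z \<in> verts Q" by simp_all
  then have "vert (vmul (vmul x y) z) = vert (vmul x (vmul y z))"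
    using mul_assoc[of "vert x" "vert y" "vert z"] vmul by simp
  then show "x \<otimes>\<^bsub>vgroup\<^esub> y \<otimes>\<^bsub>vgroup\<^esub> z = x \<otimes>\<^bsub>vgroup\<^esub> (y \<otimes>\<^bsub>vgroup\<^esub> z)" by simp
next
  fix x assume "x \<in> carrier vgroup"
  then have x: "x \<in> verts Q" by simp
  have "vert (vmul vone x) = vert x" using vmul[of vone x] x vone unit_left[of "vert x"] by simp
  then show "\<one>\<^bsub>vgroup\<^esub> \<otimes>\<^bsub>vgroup\<^esub> x = x" by simp
  show "\<exists>y\<in>carrier vgroup. y \<otimes>\<^bsub>vgroup\<^esub> x = \<one>\<^bsub>vgroup\<^esub>" using vmul_left_inverse[OF x] by simp
qed (use vmul vone in auto)

section \<open>Degree 1: translation of the spaces of arrows\<close>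

definition arrow_paths :: "'v \<Rightarrow> 'v \<Rightarrow> ('v, 'a) path set" where
  "arrow_paths x y = (\<lambda>a. (x, [a])) ` arrows Q x y"

lemma card_arrow_paths: "card (arrow_paths x y) = card (arrows Q x y)"
  unfolding arrow_paths_def by (rule card_image) (simp add: inj_on_def)

lemma arrow_paths_subset: "arrow_paths x y \<subseteq> paths Q" "arrow_paths x y \<subseteq> paths_of_length Q 1"
  by (auto simp: arrow_paths_def arrows_def paths_of_length_def)

lemma length_1:
  assumes "z \<in> free_space (paths_of_length Q 1)" "p \<in> Poly_Mapping.keys z"
  obtains a where "a \<in> arcs Q" "p = (tail Q a, [a])"
proof -
  have "p \<in> paths_of_length Q 1" using assms by (auto simp: free_space_def)
  then show ?thesis using that by (cases p) (auto simp: paths_of_length_def length_Suc_conv)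
qed

text \<open>A vertex in the right tensor factor detects the tail of an arrow, one in the left factor
  its head.\<close>

lemma lookup_comult_length_1:
  fixes z :: "('v, 'a) path \<Rightarrow>\<^sub>0 'k"
  assumes z: "z \<in> free_space (paths_of_length Q 1)"
  shows "Poly_Mapping.lookup (path_comult Q z) ((p, [b]), (q, [])) =
      (if p = q then Poly_Mapping.lookup z (p, [b]) else 0)" (is "?L1 = ?R1")
    and "Poly_Mapping.lookup (path_comult Q z) ((q, []), (p, [b])) =
      (if head Q b = q then Poly_Mapping.lookup z (p, [b]) else 0)" (is "?L2 = ?R2")
proof -
  have *: "Poly_Mapping.lookup z k * Poly_Mapping.lookup (path_comult Q (bvec k) :: _ \<Rightarrow>\<^sub>0 'k) ((p, [b]), (q, [])) =
      (if k = (p, [b]) then (if p = q then Poly_Mapping.lookup z k else 0) else 0)" (is "?P1 k")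
    "Poly_Mapping.lookup z k * Poly_Mapping.lookup (path_comult Q (bvec k) :: _ \<Rightarrow>\<^sub>0 'k) ((q, []), (p, [b])) =
      (if k = (p, [b]) then (if head Q b = q then Poly_Mapping.lookup z k else 0) else 0)" (is "?P2 k")
    if k: "k \<in> Poly_Mapping.keys z" for k
  proof -
    obtain a where a: "k = (tail Q a, [a])" using length_1[OF z k] by metis
    then have "(path_comult Q (bvec k) :: _ \<Rightarrow>\<^sub>0 'k) = bvec (k, (tail Q a, [])) + bvec ((head Q a, []), k)"
      by (simp add: path_comult_bvec)
    then show "?P1 k" "?P2 k" by (auto simp: lookup_add lookup_bvec a)
  qed
  have "?L1 = (\<Sum>k\<in>Poly_Mapping.keys z. if k = (p, [b]) then (if p = q then Poly_Mapping.lookup z k else 0) else 0)"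
    by (subst lookup_path_comult) (rule sum.cong[OF refl *(1)])
  then show "?L1 = ?R1" by (simp add: in_keys_iff)
  have "?L2 = (\<Sum>k\<in>Poly_Mapping.keys z. if k = (p, [b]) then (if head Q b = q then Poly_Mapping.lookup z k else 0) else 0)"
    by (subst lookup_path_comult) (rule sum.cong[OF refl *(2)])
  then show "?L2 = ?R2" by (simp add: in_keys_iff)
qed

text \<open>For each arrow \<open>b\<close> in the support, \<Delta> z contains \<open>b\<close>
  tensored with its tail, and its head tensored with \<open>b\<close>; the assumed form of \<Delta>
  z allows only \<open>x\<close> and \<open>y\<close> as these vertices.\<close>

lemma skew_primitive_length_1:
  assumes z: "z \<in> free_space (paths_of_length Q 1)"
    and comult: "path_comult Q z = tensor z (vert x) + tensor (vert y) z"
  shows "z \<in> free_space (arrow_paths x y)"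
proof -
  have "k \<in> arrow_paths x y" if k: "k \<in> Poly_Mapping.keys z" for k
  proof -
    obtain p b where eq: "k = (p, [b])" "b \<in> arcs Q" "tail Q b = p"
      using length_1[OF z k] by metis
    have nz: "Poly_Mapping.lookup z (p, [b]) \<noteq> 0" using k eq by (simp add: in_keys_iff)
    have "p = x"
      using lookup_comult_length_1(1)[OF z, of p b p] nz
      by (simp add: comult lookup_add lookup_bvec split: if_splits)
    moreover have "head Q b = y"
      using lookup_comult_length_1(2)[OF z, of "head Q b" p b] nz
      by (simp add: comult lookup_add lookup_bvec split: if_splits)
    ultimately show ?thesis using eq by (auto simp: arrow_paths_def arrows_def)
  qed
  then show ?thesis by (auto simp: free_space_def)
qed

lemma comult_vert: "path_comult Q (vert v) = bvec ((v, []), (v, []))"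
  by (simp add: path_comult_bvec)

lemma comult_arrow:
  assumes "p \<in> arrow_paths x y"
  shows "path_comult Q (bvec p) = bvec (p, (x, [])) + bvec ((y, []), p)"
  using assms by (auto simp: arrow_paths_def arrows_def path_comult_bvec)

text \<open>Vertices are group-like and \<Delta> is multiplicative, so translating a skew-primitive
  element by \<open>g\<close> gives one whose two vertices are translated by
  \<open>g\<close>.\<close>

lemma vert_mul_arrow:
  assumes g: "g \<in> verts Q" and xy: "x \<in> verts Q" "y \<in> verts Q" and p: "p \<in> arrow_paths x y"
  shows "mul (vert g) (bvec p) \<in> free_space (arrow_paths (vmul g x) (vmul g y))"
    and "mul (bvec p) (vert g) \<in> free_space (arrow_paths (vmul x g) (vmul y g))"
proof -
  have P: "p \<in> paths Q" "p \<in> paths_of_length Q 1" using p arrow_paths_subset by blast+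
  note m = vmul[OF g xy(1)] vmul[OF g xy(2)] vmul[OF xy(1) g] vmul[OF xy(2) g]
  show "mul (vert g) (bvec p) \<in> free_space (arrow_paths (vmul g x) (vmul g y))"
  proof (rule skew_primitive_length_1)
    show "mul (vert g) (bvec p) \<in> free_space (paths_of_length Q 1)"
      using mul_graded[of "vert g" 0 "bvec p" 1] g P by (simp add: paths_of_length_def)
    show "path_comult Q (mul (vert g) (bvec p)) =
      tensor (mul (vert g) (bvec p)) (vert (vmul g x)) + tensor (vert (vmul g y)) (mul (vert g) (bvec p))"
      using g P m by (simp add: comult_mul comult_arrow[OF p] klin_add[OF klin_tensor_mul_right] comult_vert)
  qed
  show "mul (bvec p) (vert g) \<in> free_space (arrow_paths (vmul x g) (vmul y g))"
  proof (rule skew_primitive_length_1)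
    show "mul (bvec p) (vert g) \<in> free_space (paths_of_length Q 1)"
      using mul_graded[of "bvec p" 1 "vert g" 0] g P by (simp add: paths_of_length_def)
    show "path_comult Q (mul (bvec p) (vert g)) =
      tensor (mul (bvec p) (vert g)) (vert (vmul x g)) + tensor (vert (vmul y g)) (mul (bvec p) (vert g))"
      using g P m by (simp add: comult_mul comult_arrow[OF p] klin_add[OF klin_tensor_mul_left] comult_vert)
  qed
qed

lemma linear_map_on_vert_mul:
  assumes g: "g \<in> verts Q" and xy: "x \<in> verts Q" "y \<in> verts Q"
  shows "linear_map_on (arrow_paths x y) (arrow_paths (vmul g x) (vmul g y)) (mul (vert g))"
    and "linear_map_on (arrow_paths x y) (arrow_paths (vmul x g) (vmul y g)) (\<lambda>z. mul z (vert g))"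
proof -
  have sub: "z \<in> free_space (arrow_paths x y) \<Longrightarrow> z \<in> free_space (paths Q)" for z
    using free_space_mono[OF arrow_paths_subset(1)] by blast
  have gP: "vert g \<in> free_space (paths Q)" using g by simp
  have "mul (vert g) z \<in> free_space (arrow_paths (vmul g x) (vmul g y))"
    "mul z (vert g) \<in> free_space (arrow_paths (vmul x g) (vmul y g))"
    if z: "z \<in> free_space (arrow_paths x y)" for z
    unfolding mul_lin_ext_left[OF sub[OF z] gP] mul_lin_ext_right[OF gP sub[OF z]]
    by (rule lin_ext_in_free_space[OF z], erule vert_mul_arrow[OF g xy])+
  then show "linear_map_on (arrow_paths x y) (arrow_paths (vmul g x) (vmul g y)) (mul (vert g))"
    "linear_map_on (arrow_paths x y) (arrow_paths (vmul x g) (vmul y g)) (\<lambda>z. mul z (vert g))"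
    using linear_map_on_subset[OF mul_linear_right[OF gP] arrow_paths_subset(1)]
      linear_map_on_subset[OF mul_linear_left[OF gP] arrow_paths_subset(1)] by blast+
qed

text \<open>Multiplication by \<open>g\<close> is undone by multiplication by its inverse, hence
  injective, and the dimension bound gives one inequality.\<close>

lemma card_arrows_invariant:
  assumes fin: "\<And>x y. x \<in> verts Q \<Longrightarrow> y \<in> verts Q \<Longrightarrow> finite (arrows Q x y)"
    and g: "g \<in> verts Q" and xy: "x \<in> verts Q" "y \<in> verts Q"
  shows "card (arrows Q (vmul g x) (vmul g y)) = card (arrows Q x y)"
    and "card (arrows Q (vmul x g) (vmul y g)) = card (arrows Q x y)"
proof -
  interpret V: group vgroup by (rule group_vgroup)
  let ?inv = "\<lambda>g. inv\<^bsub>vgroup\<^esub> g"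
  have closed: "?inv g \<in> verts Q" if "g \<in> verts Q" for g using V.inv_closed[of g] that by simp
  have inv: "vmul (?inv g) g = vone" "vmul g (?inv g) = vone" if "g \<in> verts Q" for g
    using V.l_inv[of g] V.r_inv[of g] that by simp_all
  have assoc: "vmul (vmul x y) z = vmul x (vmul y z)" if "x \<in> verts Q" "y \<in> verts Q" "z \<in> verts Q" for x y z
    using V.m_assoc[of x y z] that by simp
  have one: "vmul vone x = x" "vmul x vone = x" if "x \<in> verts Q" for x
    using V.l_one[of x] V.r_one[of x] that by simp_all
  have sub: "z \<in> free_space (arrow_paths x y) \<Longrightarrow> z \<in> free_space (paths Q)" for z x y
    using free_space_mono[OF arrow_paths_subset(1)] by blast
  have le: "card (arrows Q x y) \<le> card (arrows Q (vmul g x) (vmul g y))"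
    "card (arrows Q x y) \<le> card (arrows Q (vmul x g) (vmul y g))"
    if g: "g \<in> verts Q" and xy: "x \<in> verts Q" "y \<in> verts Q" for g x y
  proof -
    note lin = linear_map_on_vert_mul[OF g xy]
    have u: "mul (vert (?inv g)) (vert g) = u" "mul (vert g) (vert (?inv g)) = u"
      using vmul[of "?inv g" g] vmul[of g "?inv g"] inv[OF g] g closed[OF g] vone by auto
    have cancel: "mul (vert (?inv g)) (mul (vert g) z) = z" "mul (mul z (vert g)) (vert (?inv g)) = z"
      if z: "z \<in> free_space (paths Q)" for z
    proof -
      have "mul (vert (?inv g)) (mul (vert g) z) = mul (mul (vert (?inv g)) (vert g)) z"
        using g closed[OF g] z by (simp add: mul_assoc)
      then show "mul (vert (?inv g)) (mul (vert g) z) = z" unfolding u using unit_left[OF z] by simp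
      have "mul (mul z (vert g)) (vert (?inv g)) = mul z (mul (vert g) (vert (?inv g)))"
        using g closed[OF g] z by (simp add: mul_assoc)
      then show "mul (mul z (vert g)) (vert (?inv g)) = z" unfolding u using unit_right[OF z] by simp
    qed
    have inj: "inj_on (mul (vert g)) (free_space (arrow_paths x y))"
      "inj_on (\<lambda>z. mul z (vert g)) (free_space (arrow_paths x y))"
      by (rule inj_on_inverseI[of _ "mul (vert (?inv g))"], erule cancel(1)[OF sub],
          rule inj_on_inverseI[of _ "\<lambda>z. mul z (vert (?inv g))"], erule cancel(2)[OF sub])
    have finite: "finite (arrow_paths (vmul g x) (vmul g y))" "finite (arrow_paths (vmul x g) (vmul y g))"
      using vmul g xy by (simp_all add: arrow_paths_def fin)
    have "card (arrow_paths x y) \<le> card (arrow_paths (vmul g x) (vmul g y))"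
      "card (arrow_paths x y) \<le> card (arrow_paths (vmul x g) (vmul y g))"
      by (rule card_le_of_injective[OF lin(1) inj(1) finite(1)], rule card_le_of_injective[OF lin(2) inj(2) finite(2)])
    then show "card (arrows Q x y) \<le> card (arrows Q (vmul g x) (vmul g y))"
      "card (arrows Q x y) \<le> card (arrows Q (vmul x g) (vmul y g))"
      by (simp_all add: card_arrow_paths)
  qed
  \<comment> \<open>With this, \<open>le\<close> for the inverse of \<open>g\<close> at the
    translated vertices becomes the reverse inequality.\<close>
  have undo: "vmul (?inv g) (vmul g w) = w" "vmul (vmul w g) (?inv g) = w" if "w \<in> verts Q" for w
    using assoc[OF closed[OF g] g that, symmetric] assoc[OF that g closed[OF g]] inv[OF g] one[OF that] by simp_all
  show "card (arrows Q (vmul g x) (vmul g y)) = card (arrows Q x y)"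
    using le(1)[OF g xy] le(1)[OF closed[OF g], of "vmul g x" "vmul g y"] vmul g xy by (simp add: undo)
  show "card (arrows Q (vmul x g) (vmul y g)) = card (arrows Q x y)"
    using le(2)[OF g xy] le(2)[OF closed[OF g], of "vmul x g" "vmul y g"] vmul g xy by (simp add: undo)
qed

end

text \<open>Finiteness of the arrow sets makes the arrow counts natural numbers, as the coefficients
  of a ramification data are.\<close>

theorem theorem3p3:
  fixes Q :: "('v, 'a) pre_digraph"
  assumes "wf_digraph Q"
    and "\<forall>x\<in>verts Q. \<forall>y\<in>verts Q. finite {a \<in> arcs Q. tail Q a = x \<and> head Q a = y}"
  shows "(\<exists>(mul :: (('v, 'a) path \<Rightarrow>\<^sub>0 'k::field) \<Rightarrow> (('v, 'a) path \<Rightarrow>\<^sub>0 'k) \<Rightarrow>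
                    (('v, 'a) path \<Rightarrow>\<^sub>0 'k)) u S. graded_hopf_structure Q mul u S)
         \<longleftrightarrow>
         (\<exists>(G :: 'v monoid) r. group G \<and> ramification_data G r \<and>
                    digraph_iso Q (hopf_quiver G r))"
    (is "?hopf \<longleftrightarrow> ?quiver")
proof
  assume ?hopf
  then obtain mul u and S :: "(('v, 'a) path \<Rightarrow>\<^sub>0 'k) \<Rightarrow> (('v, 'a) path \<Rightarrow>\<^sub>0 'k)"
    where "graded_hopf_structure Q mul u S" by blast
  then interpret graded_hopf_quiver Q mul u S
    using assms(1) by (simp add: graded_hopf_quiver_def)
  have fin: "finite (arrows Q x y)" if "x \<in> verts Q" "y \<in> verts Q" for x y
    using assms(2) that by (simp add: arrows_def)
  have "\<exists>r. ramification_data vgroup r \<and> digraph_iso Q (hopf_quiver vgroup r)"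
    by (rule hopf_quiver_of_invariant_arrows[OF assms(1) group_vgroup])
      (simp_all add: fin card_arrows_invariant)
  then show ?quiver using group_vgroup by blast
next
  assume ?quiver
  then obtain H L R where "biaction_quiver Q H L R"
    using biaction_quiver_of_iso[OF assms(1)] by blast
  then interpret biaction_quiver Q H L R .
  show ?hopf using graded_hopf_structure_shuffle_mul by blast
qed

end
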